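(* Let $\mathbf{H}\in\mathbb{C}^{4\times4}$ be the effective channel matrix of any one of the three variations of the golden code (Dayal-Varanasi, Belfiore-Rekaya-Viterbo, or WiMAX), as defined in the context, for arbitrary (possibly time-varying) channel coefficients $h_{i,j}[k]\in\mathbb{C}$, $i,j,k\in\{1,2\}$. Let $\mathcal{A}$ be an $M$-ary (square) QAM alphabet. There is an algorithm that, given any such coefficients, any $\mathbf{y}\in\mathbb{C}^4$ and $M$, outputs a maximum-likelihood decision $$\hat{\mathbf{x}}\in\operatorname{argmin}_{\mathbf{x}\in\mathcal{A}^4}\|\mathbf{y}-\mathbf{H}\mathbf{x}\|^2,$$ and whose worst-case complexity (number of elementary operations, over all inputs with alphabet size $M$) is $\mathcal{O}(2M^{2.5})$, that is, at most a constant times $M^{2.5}$, the constant being independent of $M$, $\mathbf{y}$ and the channel coefficients.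
   Context: Alphabet: $M$ is such that $\sqrt{M}\ge 2$ is an integer, and $\mathcal{A}=\{a+ib : a,b\in\mathcal{P}\}$, where $\mathcal{P}=\{2k-1-\sqrt{M} : k=1,\dots,\sqrt{M}\}$ is the $\sqrt{M}$-ary PAM alphabet and $i=\sqrt{-1}$. Complexity model: elementary operations, each of unit cost, are exact real arithmetic operations (including square roots), comparisons, and rounding a real number to a nearest integer. In particular, a PAM slicer (finding an element of $\mathcal{P}$ closest to a given real number), implemented with a multiplication, a rounding, an addition and a hard-limiting operation, has cost $\mathcal{O}(1)$ independent of $M$. Effective channel matrices: let $\theta=\tfrac12\tan^{-1}(2)$, $c=\cos\theta$, $s=\sin\theta$, $\varphi=e^{i\pi/4}$, and $$\Psi=\begin{bmatrix} c & s & 0 & 0\\ -s & c & 0 & 0\\ 0 & 0 & c & s\\ 0 & 0 & -s & c\end{bmatrix}.$$ The coefficient $h_{i,j}[k]$ is the channel gain from transmit antenna $i$ to receive antenna $j$ at time $k$; below, $h_{ij}[k]=h_{i,j}[k]$. Dayal-Varanasi: $$\mathbf{H}=\begin{bmatrix} h_{11}[1] & 0 & \varphi h_{21}[1] & 0\\ 0 & h_{21}[2] & 0 & \varphi h_{11}[2]\\ h_{12}[1] & 0 & \varphi h_{22}[1] & 0\\ 0 & h_{22}[2] & 0 & \varphi h_{12}[2]\end{bmatrix}\Psi.$$ Belfiore-Rekaya-Viterbo: $$\mathbf{H}=\begin{bmatrix} h_{11}[1] & 0 & h_{21}[1] & 0\\ 0 & h_{21}[2] & 0 & i h_{11}[2]\\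 h_{12}[1] & 0 & h_{22}[1] & 0\\ 0 & h_{22}[2] & 0 & i h_{12}[2]\end{bmatrix}\operatorname{diag}(c-si,\ s+ci,\ c-si,\ s+ci)\,\Psi.$$ WiMAX: $$\mathbf{H}=\begin{bmatrix} h_{11}[1] & 0 & h_{21}[1] & 0\\ 0 & -i h_{21}[2] & 0 & -h_{11}[2]\\ h_{12}[1] & 0 & h_{22}[1] & 0\\ 0 & -i h_{22}[2] & 0 & -h_{12}[2]\end{bmatrix}\Psi.$$ The received vector is $\mathbf{y}=\mathbf{H}\mathbf{x}+\mathbf{n}$ with $\mathbf{x}\in\mathcal{A}^4$ the information symbols and $\mathbf{n}$ white Gaussian noise, so maximum-likelihood decoding is the minimization of $\|\mathbf{y}-\mathbf{H}\mathbf{x}\|^2$ (squared Euclidean norm) over $\mathcal{A}^4$. *)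

theory Defs
  imports "HOL-Analysis.Analysis"
begin

definition pam :: "nat \<Rightarrow> real set" where
  "pam M = {2 * real k - 1 - sqrt (real M) | k :: nat. 1 \<le> k \<and> real k \<le> sqrt (real M)}"

definition qam :: "nat \<Rightarrow> complex set" where
  "qam M = {complex_of_real a + \<i> * complex_of_real b | a b. a \<in> pam M \<and> b \<in> pam M}"

definition square_size :: "nat \<Rightarrow> bool" where
  "square_size M \<longleftrightarrow> sqrt (real M) \<in> \<nat> \<and> 2 \<le> sqrt (real M)"

text \<open>\<open>h i j k\<close> is the gain from transmit antenna \<open>i\<close> to receive antenna \<open>j\<close> at time \<open>k\<close>. The index
  type \<open>2\<close> has exactly the two elements \<open>1\<close> and \<open>2\<close> (the latter being also its \<open>0\<close>).\<close>

type_synonym channel = "2 \<Rightarrow> 2 \<Rightarrow> 2 \<Rightarrow> complex"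

definition theta :: real where
  "theta = arctan 2 / 2"

abbreviation cth :: complex where
  "cth \<equiv> complex_of_real (cos theta)"

abbreviation sth :: complex where
  "sth \<equiv> complex_of_real (sin theta)"

definition phi :: complex where
  "phi = exp (\<i> * complex_of_real (pi / 4))"

definition Psi :: "complex^4^4" where
  "Psi = vector [
     vector [ cth, sth,    0,   0],
     vector [-sth, cth,    0,   0],
     vector [   0,   0,  cth, sth],
     vector [   0,   0, -sth, cth]]"

definition diag_mat :: "'a::zero^'n \<Rightarrow> 'a^'n^'n" where
  "diag_mat v = (\<chi> i j. if i = j then v $ i else 0)"

definition dayal_varanasi :: "channel \<Rightarrow> complex^4^4" where
  "dayal_varanasi h = vector [
     vector [h 1 1 1,       0, phi * h 2 1 1,             0],
     vector [      0, h 2 1 2,             0, phi * h 1 1 2],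
     vector [h 1 2 1,       0, phi * h 2 2 1,             0],
     vector [      0, h 2 2 2,             0, phi * h 1 2 2]] ** Psi"

definition belfiore_rekaya_viterbo :: "channel \<Rightarrow> complex^4^4" where
  "belfiore_rekaya_viterbo h = vector [
     vector [h 1 1 1,       0, h 2 1 1,           0],
     vector [      0, h 2 1 2,       0, \<i> * h 1 1 2],
     vector [h 1 2 1,       0, h 2 2 1,           0],
     vector [      0, h 2 2 2,       0, \<i> * h 1 2 2]]
     ** diag_mat (vector [cth - sth * \<i>, sth + cth * \<i>, cth - sth * \<i>, sth + cth * \<i>]) ** Psi"

definition wimax :: "channel \<Rightarrow> complex^4^4" where
  "wimax h = vector [
     vector [h 1 1 1,              0, h 2 1 1,          0],
     vector [      0, - \<i> * h 2 1 2,       0, - h 1 1 2],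
     vector [h 1 2 1,              0, h 2 2 1,          0],
     vector [      0, - \<i> * h 2 2 2,       0, - h 1 2 2]] ** Psi"

definition ml_decision :: "complex^4^4 \<Rightarrow> nat \<Rightarrow> complex^4 \<Rightarrow> complex^4 \<Rightarrow> bool" where
  "ml_decision H M y xhat \<longleftrightarrow>
     is_arg_min (\<lambda>x. (norm (y - H *v x))\<^sup>2) (\<lambda>x. \<forall>i. x $ i \<in> qam M) xhat"

text \<open>Algorithms are programs of a structured real random access machine: the memory is an array
  of real cells, with direct and indirect addressing, and the elementary operations are exact real
  arithmetic (including square roots), comparisons, and rounding to a nearest integer (ties upwards).
  Only integer constants are available, so that no information can be hidden in a real constant.
  Dividing by zero, taking the root of a negative number, and using an address that is not a natural
  number are errors: such an execution has no result, regardless of the values that HOL's total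
  functions assign.\<close>

type_synonym memory = "nat \<Rightarrow> real"

datatype expr =
    Const int
  | Cell nat
  | Indirect expr
  | Add expr expr
  | Sub expr expr
  | Mul expr expr
  | Div expr expr
  | Sqrt expr
  | Round expr

datatype test =
    Less expr expr
  | LessEq expr expr
  | Equal expr expr

datatype prog =
    Skip
  | Assign nat expr
  | Store expr expr
  | Seq prog prog
  | Cond test prog prog
  | While test prog

definition address :: "real \<Rightarrow> nat" where
  "address r = nat \<lfloor>r\<rfloor>"

fun eval :: "expr \<Rightarrow> memory \<Rightarrow> real" where
  "eval (Const k) m = of_int k"
| "eval (Cell n) m = m n"
| "eval (Indirect a) m = m (address (eval a m))"
| "eval (Add a b) m = eval a m + eval b m"
| "eval (Sub a b) m = eval a m - eval b m"
| "eval (Mul a b) m = eval a m * eval b m"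
| "eval (Div a b) m = eval a m / eval b m"
| "eval (Sqrt a) m = sqrt (eval a m)"
| "eval (Round a) m = of_int (round (eval a m))"

fun defined :: "expr \<Rightarrow> memory \<Rightarrow> bool" where
  "defined (Const k) m \<longleftrightarrow> True"
| "defined (Cell n) m \<longleftrightarrow> True"
| "defined (Indirect a) m \<longleftrightarrow> defined a m \<and> eval a m \<in> \<nat>"
| "defined (Add a b) m \<longleftrightarrow> defined a m \<and> defined b m"
| "defined (Sub a b) m \<longleftrightarrow> defined a m \<and> defined b m"
| "defined (Mul a b) m \<longleftrightarrow> defined a m \<and> defined b m"
| "defined (Div a b) m \<longleftrightarrow> defined a m \<and> defined b m \<and> eval b m \<noteq> 0"
| "defined (Sqrt a) m \<longleftrightarrow> defined a m \<and> 0 \<le> eval a m"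
| "defined (Round a) m \<longleftrightarrow> defined a m"

fun ops :: "expr \<Rightarrow> nat" where
  "ops (Const k) = 0"
| "ops (Cell n) = 0"
| "ops (Indirect a) = ops a + 1"
| "ops (Add a b) = ops a + ops b + 1"
| "ops (Sub a b) = ops a + ops b + 1"
| "ops (Mul a b) = ops a + ops b + 1"
| "ops (Div a b) = ops a + ops b + 1"
| "ops (Sqrt a) = ops a + 1"
| "ops (Round a) = ops a + 1"

fun holds :: "test \<Rightarrow> memory \<Rightarrow> bool" where
  "holds (Less a b) m \<longleftrightarrow> eval a m < eval b m"
| "holds (LessEq a b) m \<longleftrightarrow> eval a m \<le> eval b m"
| "holds (Equal a b) m \<longleftrightarrow> eval a m = eval b m"

fun test_defined :: "test \<Rightarrow> memory \<Rightarrow> bool" where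
  "test_defined (Less a b) m \<longleftrightarrow> defined a m \<and> defined b m"
| "test_defined (LessEq a b) m \<longleftrightarrow> defined a m \<and> defined b m"
| "test_defined (Equal a b) m \<longleftrightarrow> defined a m \<and> defined b m"

fun test_ops :: "test \<Rightarrow> nat" where
  "test_ops (Less a b) = ops a + ops b + 1"
| "test_ops (LessEq a b) = ops a + ops b + 1"
| "test_ops (Equal a b) = ops a + ops b + 1"

text \<open>\<open>exec p m t m'\<close>: started in memory \<open>m\<close>, the program \<open>p\<close> halts without error in memory \<open>m'\<close>
  after \<open>t\<close> elementary operations. Writing a cell and indirect reading are charged one unit as well,
  which can only increase the count.\<close>

inductive exec :: "prog \<Rightarrow> memory \<Rightarrow> nat \<Rightarrow> memory \<Rightarrow> bool" where
  exec_Skip: "exec Skip m 0 m"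
| exec_Assign: "defined e m \<Longrightarrow> exec (Assign n e) m (ops e + 1) (m(n := eval e m))"
| exec_Store: "defined a m \<Longrightarrow> eval a m \<in> \<nat> \<Longrightarrow> defined e m \<Longrightarrow>
    exec (Store a e) m (ops a + ops e + 1) (m(address (eval a m) := eval e m))"
| exec_Seq: "exec p m t m' \<Longrightarrow> exec q m' u m'' \<Longrightarrow> exec (Seq p q) m (t + u) m''"
| exec_CondTrue: "test_defined b m \<Longrightarrow> holds b m \<Longrightarrow> exec p m t m' \<Longrightarrow>
    exec (Cond b p q) m (test_ops b + t) m'"
| exec_CondFalse: "test_defined b m \<Longrightarrow> \<not> holds b m \<Longrightarrow> exec q m t m' \<Longrightarrow>
    exec (Cond b p q) m (test_ops b + t) m'"
| exec_WhileFalse: "test_defined b m \<Longrightarrow> \<not> holds b m \<Longrightarrow>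
    exec (While b p) m (test_ops b) m"
| exec_WhileTrue: "test_defined b m \<Longrightarrow> holds b m \<Longrightarrow> exec p m t m' \<Longrightarrow>
    exec (While b p) m' u m'' \<Longrightarrow> exec (While b p) m (test_ops b + t + u) m''"

text \<open>Execution is deterministic, so the existence of a run is termination, and its length is the
  running time.\<close>

inductive_cases exec_SkipE: "exec Skip m t m'"
inductive_cases exec_AssignE: "exec (Assign n e) m t m'"
inductive_cases exec_StoreE: "exec (Store a e) m t m'"
inductive_cases exec_SeqE: "exec (Seq p q) m t m'"
inductive_cases exec_CondE: "exec (Cond b p q) m t m'"
inductive_cases exec_WhileE: "exec (While b p) m t m'"

lemma exec_deterministic:
  "exec p m t m' \<Longrightarrow> exec p m u m'' \<Longrightarrow> u = t \<and> m'' = m'"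
proof (induction arbitrary: u m'' rule: exec.induct)
  case exec_Skip then show ?case by (auto elim: exec_SkipE)
next
  case exec_Assign then show ?case by (auto elim: exec_AssignE)
next
  case exec_Store then show ?case by (auto elim: exec_StoreE)
next
  case (exec_Seq p m t m' q v m1) then show ?case by (metis exec_SeqE)
next
  case exec_CondTrue then show ?case by (metis exec_CondE)
next
  case exec_CondFalse then show ?case by (metis exec_CondE)
next
  case exec_WhileFalse then show ?case by (metis exec_WhileE)
next
  case exec_WhileTrue then show ?case by (metis exec_WhileE)
qed

text \<open>Input: cell 0 holds \<open>M\<close>, cells 1--16 the real and imaginary parts of the eight channel
  coefficients, cells 17--24 those of \<open>y\<close>; all other cells are 0. The decision is read off from
  cells 0--7, again as real and imaginary parts.\<close>

definition input_list :: "nat \<Rightarrow> channel \<Rightarrow> complex^4 \<Rightarrow> real list" where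
  "input_list M h y = real M # concat (map (\<lambda>z. [Re z, Im z])
     [h 1 1 1, h 1 1 2, h 1 2 1, h 1 2 2, h 2 1 1, h 2 1 2, h 2 2 1, h 2 2 2,
      y $ 1, y $ 2, y $ 3, y $ 4])"

definition input_memory :: "nat \<Rightarrow> channel \<Rightarrow> complex^4 \<Rightarrow> memory" where
  "input_memory M h y n = (let l = input_list M h y in if n < length l then l ! n else 0)"

definition output_vector :: "memory \<Rightarrow> complex^4" where
  "output_vector m = vector [Complex (m 0) (m 1), Complex (m 2) (m 3),
                             Complex (m 4) (m 5), Complex (m 6) (m 7)]"

end

(* The squared distance is a function F of eight PAM coordinates. Before multiplication by Psi, each
   row of the channel matrix has a single entry among the columns 1, 2, and Psi is real, so for fixed
   symbols 3 and 4 every entry of the residual has the form w - g (A + iB) with A real linear in the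
   real parts of symbols 1 and 2 and B in their imaginary parts. Hence F splits into a function of
   the two real parts plus a function of the two imaginary parts, and these can be minimized one
   after the other. In each of the two problems the coordinate of symbol 2 is enumerated and that of
   symbol 1 is found by slicing, F being a quadratic in it. For each of the M^2 choices of the symbols
   3 and 4 this costs O(sqrt M). *)

theory Submission
  imports Defs
begin

subsection \<open>Running times\<close>

text \<open>The exponent comes from counting loops: with N = sqrt M, four loops over the coordinates
  of symbols 3 and 4 enclose two consecutive loops over a coordinate of symbol 2. The nesting depth
  is 5, and N^5 = M^(5/2). The constant must not depend on M, the channel or y, so one program is
  fixed per code and N is computed at run time. As only integer constants exist, cos theta, sin
  theta and phi are built from square roots. The search never sees a channel matrix. It evaluates F
  as a black box of constant cost; besides nonnegativity and the quadratic shape it relies on an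
  exchange identity: if u and v agree on symbols 3 and 4, then F u + F v is unchanged when u and v
  swap the imaginary parts of symbols 1 and 2. This states the splitting of F without naming the two
  summands, and it remains valid for singular channels.\<close>

fun cost :: "prog \<Rightarrow> nat \<Rightarrow> nat" where
  "cost Skip N = 0"
| "cost (Assign n e) N = ops e + 1"
| "cost (Store a e) N = ops a + ops e + 1"
| "cost (Seq p q) N = cost p N + cost q N"
| "cost (Cond b p q) N = test_ops b + (cost p N + cost q N)"
| "cost (While b p) N = N * (test_ops b + cost p N) + test_ops b"

fun depth :: "prog \<Rightarrow> nat" where
  "depth Skip = 0"
| "depth (Assign n e) = 0"
| "depth (Store a e) = 0"
| "depth (Seq p q) = max (depth p) (depth q)"
| "depth (Cond b p q) = max (depth p) (depth q)"
| "depth (While b p) = Suc (depth p)"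

text \<open>\<open>cost p N\<close> is a polynomial in N with natural coefficients, of degree at
  most \<open>depth p\<close>: a conditional is charged for both branches, and each loop multiplies
  by N. Its value at 1 is the sum of the coefficients.\<close>

lemma cost_le_power_depth:
  assumes "1 \<le> N"
  shows "cost p N \<le> cost p 1 * N ^ depth p"
proof (induction p)
  case (Seq p q)
  have "cost p N \<le> cost p 1 * N ^ max (depth p) (depth q)"
    using Seq.IH(1) assms by (meson le_trans max.cobounded1 mult_le_mono2 power_increasing)
  moreover have "cost q N \<le> cost q 1 * N ^ max (depth p) (depth q)"
    using Seq.IH(2) assms by (meson le_trans max.cobounded2 mult_le_mono2 power_increasing)
  ultimately show ?case by (simp add: distrib_right)
next
  case (Cond b p q)
  have "cost p N \<le> cost p 1 * N ^ max (depth p) (depth q)"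
    using Cond.IH(1) assms by (meson le_trans max.cobounded1 mult_le_mono2 power_increasing)
  moreover have "cost q N \<le> cost q 1 * N ^ max (depth p) (depth q)"
    using Cond.IH(2) assms by (meson le_trans max.cobounded2 mult_le_mono2 power_increasing)
  moreover have "test_ops b \<le> test_ops b * N ^ max (depth p) (depth q)"
    using assms by simp
  ultimately show ?case
    unfolding cost.simps depth.simps distrib_right by linarith
next
  case (While b p)
  have *: "test_ops b \<le> test_ops b * N ^ n" for n
    using assms by simp
  have "test_ops b + cost p N \<le> (test_ops b + cost p 1) * N ^ depth p"
    unfolding distrib_right using While.IH *[of "depth p"] by linarith
  then have "N * (test_ops b + cost p N) \<le> N * ((test_ops b + cost p 1) * N ^ depth p)"
    by (rule mult_le_mono2)
  moreover have "cost (While b p) 1 * N ^ depth (While b p) =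
      N * ((test_ops b + cost p 1) * N ^ depth p) + test_ops b * N ^ Suc (depth p)"
    by (simp add: algebra_simps)
  ultimately show ?case
    unfolding cost.simps using *[of "Suc (depth p)"] by linarith
qed simp_all

text \<open>\<open>cost p N\<close> bounds the running time as long as every loop makes at most \<open>N\<close> passes.\<close>

definition runs :: "nat \<Rightarrow> prog \<Rightarrow> memory \<Rightarrow> (memory \<Rightarrow> bool) \<Rightarrow> bool" where
  "runs N p m Q \<longleftrightarrow> (\<exists>t m'. exec p m t m' \<and> t \<le> cost p N \<and> Q m')"

lemma runs_mono: "runs N p m Q \<Longrightarrow> (\<And>m'. Q m' \<Longrightarrow> R m') \<Longrightarrow> runs N p m R"
  unfolding runs_def by blast

lemma runs_Skip: "Q m \<Longrightarrow> runs N Skip m Q"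
  unfolding runs_def using exec_Skip by fastforce

lemma runs_Assign: "defined e m \<Longrightarrow> Q (m(n := eval e m)) \<Longrightarrow> runs N (Assign n e) m Q"
  unfolding runs_def using exec_Assign by fastforce

lemma runs_Seq: "runs N p m (\<lambda>m'. runs N q m' Q) \<Longrightarrow> runs N (Seq p q) m Q"
  unfolding runs_def by (fastforce intro: exec_Seq add_mono)

lemma runs_Cond:
  assumes "test_defined b m" "holds b m \<Longrightarrow> runs N p m Q" "\<not> holds b m \<Longrightarrow> runs N q m Q"
  shows "runs N (Cond b p q) m Q"
proof (cases "holds b m")
  case True
  then obtain t m' where "exec p m t m'" "t \<le> cost p N" "Q m'"
    using assms(2) unfolding runs_def by blast
  then show ?thesis
    unfolding runs_def using exec_CondTrue[OF assms(1) True]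
    by (intro exI[of _ "test_ops b + t"] exI[of _ m']) auto
next
  case False
  then obtain t m' where "exec q m t m'" "t \<le> cost q N" "Q m'"
    using assms(3) unfolding runs_def by blast
  then show ?thesis
    unfolding runs_def using exec_CondFalse[OF assms(1) False]
    by (intro exI[of _ "test_ops b + t"] exI[of _ m']) auto
qed

text \<open>The bound is read from a cell because it depends on the input, while a program has only
  integer constants.\<close>

definition For :: "nat \<Rightarrow> nat \<Rightarrow> prog \<Rightarrow> prog" where
  "For n c p = Seq (Assign c (Const 0))
     (While (Less (Cell c) (Cell n)) (Seq p (Assign c (Add (Cell c) (Const 1)))))"

text \<open>\<open>I i\<close> is the invariant at the loop head with counter \<open>i\<close>. The
  body must leave the counter alone, since the increment follows it. The number of passes is the
  same \<open>N\<close> that \<open>cost\<close> charges for every loop.\<close>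

lemma runs_For:
  assumes init: "I 0 (m(c := 0))"
    and cells: "\<And>i m. I i m \<Longrightarrow> m c = real i \<and> m n = real N"
    and step: "\<And>i m. i < N \<Longrightarrow> I i m \<Longrightarrow>
      runs N p m (\<lambda>m'. m' c = real i \<and> I (Suc i) (m'(c := real (Suc i))))"
    and post: "\<And>m. I N m \<Longrightarrow> Q m"
  shows "runs N (For n c p) m Q"
proof -
  let ?b = "Less (Cell c) (Cell n)"
  let ?p = "Seq p (Assign c (Add (Cell c) (Const 1)))"
  \<comment> \<open>The budget is stated for the passes that remain plus the final failing test;
    \<open>cost\<close> covers only the case i = 0.\<close>
  have loop: "I i m \<Longrightarrow> i \<le> N \<Longrightarrow>
      \<exists>t m'. exec (While ?b ?p) m t m' \<and> t \<le> (N - i) * (test_ops ?b + cost ?p N) + test_ops ?b \<and> Q m'"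
    for i m
  proof (induction "N - i" arbitrary: i m)
    case 0
    then have "i = N" by simp
    then have "\<not> holds ?b m" "Q m"
      using 0 cells[of i m] post by auto
    moreover have "test_defined ?b m" by simp
    ultimately show ?case using exec_WhileFalse by fastforce
  next
    case (Suc d)
    then have "i < N" by simp
    have "runs N ?p m (I (Suc i))"
      by (rule runs_Seq, rule runs_mono[OF step[OF \<open>i < N\<close> \<open>I i m\<close>]])
        (auto intro!: runs_Assign simp: add.commute)
    then obtain t m1 where 1: "exec ?p m t m1" "t \<le> cost ?p N" "I (Suc i) m1"
      unfolding runs_def by blast
    from Suc.hyps(1)[of "Suc i" m1] 1(3) Suc.hyps(2) \<open>i < N\<close> obtain u m2 where
      2: "exec (While ?b ?p) m1 u m2" "Q m2"
         "u \<le> (N - Suc i) * (test_ops ?b + cost ?p N) + test_ops ?b" by force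
    have "test_defined ?b m" "holds ?b m"
      using cells[OF \<open>I i m\<close>] \<open>i < N\<close> by auto
    from this 1(1) 2(1) have "exec (While ?b ?p) m (test_ops ?b + t + u) m2" by (rule exec_WhileTrue)
    moreover have "N - i = Suc (N - Suc i)"
      using \<open>i < N\<close> by simp
    then have "test_ops ?b + t + u \<le> (N - i) * (test_ops ?b + cost ?p N) + test_ops ?b"
      using 1(2) 2(3) by simp
    ultimately show ?case using 2(2) by blast
  qed
  have "runs N (While ?b ?p) (m(c := 0)) Q"
    using loop[OF init] unfolding runs_def by simp
  then show ?thesis
    unfolding For_def by (intro runs_Seq runs_Assign) auto
qed

subsection \<open>Slicing\<close>

text \<open>The difference of the two squares is (j - i) (j + i - 2 x). Both factors have the same
  sign: distinct integers differ by at least 1, and rounding errs by at most 1/2.\<close>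

lemma clipped_round_nearest:
  fixes x :: real and i j :: int
  assumes "round x \<le> i \<and> i \<le> j \<or> j \<le> i \<and> i \<le> round x"
  shows "(real_of_int i - x)\<^sup>2 \<le> (real_of_int j - x)\<^sup>2"
proof (cases "i = j")
  case False
  have r: "\<bar>of_int (round x) - x\<bar> \<le> 1 / 2" by (rule of_int_round_abs_le)
  have "0 \<le> (real_of_int j - real_of_int i) * (real_of_int j + real_of_int i - 2 * x)"
  proof (cases "round x \<le> i \<and> i \<le> j")
    case True
    then have "i + 1 \<le> j" "round x \<le> i" using False by auto
    then have "real_of_int i + 1 \<le> j" "real_of_int (round x) \<le> i" by linarith+
    then show ?thesis using r by (intro mult_nonneg_nonneg) linarith+
  next
    case False
    then have "j + 1 \<le> i" "i \<le> round x" using assms \<open>i \<noteq> j\<close> by auto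
    then have "real_of_int j + 1 \<le> i" "real_of_int i \<le> round x" by linarith+
    then show ?thesis using r by (intro mult_nonpos_nonpos) linarith+
  qed
  then show ?thesis by (simp add: power2_eq_square algebra_simps)
qed simp

lemma nonneg_quadratic_coeffs:
  fixes a b c :: real
  assumes "\<And>t. 0 \<le> a * t\<^sup>2 + b * t + c"
  shows "0 \<le> a" "a = 0 \<Longrightarrow> b = 0"
proof -
  show b: "b = 0" if "a = 0"
  proof (rule ccontr)
    assume "b \<noteq> 0"
    \<comment> \<open>At this point the linear function b t + c takes the value -1.\<close>
    then show False using assms[of "(- c - 1) / b"] that by simp
  qed
  show "0 \<le> a"
  proof (rule ccontr)
    assume a: "\<not> 0 \<le> a"
    \<comment> \<open>Chosen so that a s^2 = a s - |b| s - |c| s. As s is at least 1, the last two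
      terms absorb b s and c, and the quadratic is at most a s < 0.\<close>
    define s where "s = 1 + \<bar>b\<bar> / - a + \<bar>c\<bar> / - a"
    have "0 \<le> \<bar>b\<bar> / - a" "0 \<le> \<bar>c\<bar> / - a" using a by (simp_all add: divide_nonneg_neg divide_nonpos_neg divide_le_0_iff)
    then have s1: "1 \<le> s" unfolding s_def by linarith
    have e: "- a * s = - a + \<bar>b\<bar> + \<bar>c\<bar>" unfolding s_def using a by (simp add: field_simps)
    have "c \<le> \<bar>c\<bar> * s" using s1 by (smt (verit) mult_left_mono mult_cancel_left1 mult.commute abs_ge_zero)
    moreover have "b * s \<le> \<bar>b\<bar> * s" using s1 by (intro mult_right_mono) auto
    moreover have "a * s\<^sup>2 = - (- a * s) * s" by (simp add: power2_eq_square)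
    then have "a * s\<^sup>2 = a * s - \<bar>b\<bar> * s - \<bar>c\<bar> * s" unfolding e by (simp add: algebra_simps)
    moreover have "a * s < 0" using a s1 by (simp add: mult_less_0_iff)
    ultimately show False using assms[of s] by linarith
  qed
qed

definition clip :: "nat \<Rightarrow> int \<Rightarrow> int" where
  "clip N r = (if r < 0 then 0 else if int N - 1 < r then int N - 1 else r)"

text \<open>For a > 0, completing the square reduces the claim to the distance from the vertex. For
  a = 0 nonnegativity forces b = 0, so that \<open>r\<close> may be arbitrary.\<close>

lemma clip_minimizes_quadratic:
  fixes a b c :: real
  assumes nonneg: "\<And>t. 0 \<le> a * t\<^sup>2 + b * t + c" and "j < N"
    and r: "a \<noteq> 0 \<Longrightarrow> r = round (- b / (2 * a))"
  shows "a * (real_of_int (clip N r))\<^sup>2 + b * real_of_int (clip N r) + c \<le> a * (real j)\<^sup>2 + b * real j + c"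
proof (cases "a = 0")
  case True
  then show ?thesis using nonneg_quadratic_coeffs[OF nonneg] by simp
next
  case False
  let ?x = "- b / (2 * a)"
  have a: "0 \<le> a" using nonneg_quadratic_coeffs[OF nonneg] by simp
  \<comment> \<open>Limiting \<open>r\<close> to 0..N-1 puts the result between \<open>r\<close> and
    every admissible digit.\<close>
  have "r \<le> clip N r \<and> clip N r \<le> int j \<or> int j \<le> clip N r \<and> clip N r \<le> r"
    using \<open>j < N\<close> by (auto simp: clip_def)
  then have "(real_of_int (clip N r) - ?x)\<^sup>2 \<le> (real_of_int (int j) - ?x)\<^sup>2"
    unfolding r[OF False] by (rule clipped_round_nearest)
  then have "a * (real_of_int (clip N r) - ?x)\<^sup>2 \<le> a * (real j - ?x)\<^sup>2"
    using a by (intro mult_left_mono) auto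
  moreover have "a * t\<^sup>2 + b * t = a * (t - ?x)\<^sup>2 - b\<^sup>2 / (4 * a)" for t
    using False by (simp add: power2_eq_square field_simps)
  ultimately show ?thesis by simp
qed

subsection \<open>The search\<close>

text \<open>Parity keeps the candidate and the best digits apart, and the offset keeps both clear of
  the input and of the working cells.\<close>

definition cand :: "nat \<Rightarrow> nat" where "cand k = 2 * k + 30"
definition best :: "nat \<Rightarrow> nat" where "best k = 2 * k + 31"

lemma cand_best_simps [simp]:
  "cand j = cand k \<longleftrightarrow> j = k" "best j = best k \<longleftrightarrow> j = k" "cand j \<noteq> best k" "best k \<noteq> cand j"
  "27 < cand k" "27 < best k" "25 < cand k" "25 < best k"
  "cand k \<noteq> 25" "cand k \<noteq> 26" "cand k \<noteq> 27" "best k \<noteq> 25" "best k \<noteq> 26" "best k \<noteq> 27"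
  unfolding cand_def best_def by presburger+

lemma cand_best_simps' [simp]:
  "25 \<noteq> cand k" "26 \<noteq> cand k" "27 \<noteq> cand k" "25 \<noteq> best k" "26 \<noteq> best k" "27 \<noteq> best k"
  using cand_best_simps by metis+

text \<open>Cell 25 holds \<open>N = sqrt M\<close>, cells 26 and 27 the trial digits. Coordinate \<open>2 * k\<close> is the real and
  \<open>2 * k + 1\<close> the imaginary part of symbol \<open>k + 1\<close>; a digit \<open>t\<close> in \<open>{0..<N}\<close> stands for the PAM point
  \<open>2 * t + 1 - N\<close>.\<close>

text \<open>The coefficients of the quadratic in coordinate \<open>k\<close> are read off from its values at -1, 0 and 1.
  A zero leading coefficient means a constant function, where any digit will do.\<close>

definition slice :: "((nat \<Rightarrow> expr) \<Rightarrow> expr) \<Rightarrow> (nat \<Rightarrow> expr) \<Rightarrow> nat \<Rightarrow> prog" where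
  "slice obj ce k =
    (let q = (\<lambda>t. obj (ce(k := Const t)));
         d = Sub (Add (q 1) (q (-1))) (Mul (Const 2) (q 0)) in
     Seq (Cond (Equal d (Const 0)) (Assign 26 (Const 0))
            (Assign 26 (Round (Div (Sub (q (-1)) (q 1)) (Mul (Const 2) d)))))
         (Cond (Less (Cell 26) (Const 0)) (Assign 26 (Const 0))
            (Cond (Less (Sub (Cell 25) (Const 1)) (Cell 26))
               (Assign 26 (Sub (Cell 25) (Const 1))) Skip)))"

definition cand_expr :: "nat \<Rightarrow> expr" where
  "cand_expr j = Cell (cand j)"

definition best_expr :: "nat \<Rightarrow> expr" where
  "best_expr j = Cell (best j)"

text \<open>With \<open>k = 0\<close> (real parts) or \<open>k = 1\<close> (imaginary parts), coordinate \<open>k\<close> belongs to symbol 1 and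
  \<open>k + 2\<close> to symbol 2.\<close>

definition trial_expr :: "nat \<Rightarrow> nat \<Rightarrow> expr" where
  "trial_expr k = cand_expr(k := Cell 26, k + 2 := Cell 27)"

text \<open>The values found on entry serve as the first incumbent, so nothing is reset. A trial
  replaces both coordinates that the loop may have changed; the trials are therefore all compared
  against the same remaining coordinates.\<close>

definition block :: "((nat \<Rightarrow> expr) \<Rightarrow> expr) \<Rightarrow> nat \<Rightarrow> prog" where
  "block obj k = For 25 27
     (Seq (slice obj (trial_expr k) k)
       (Cond (Less (obj (trial_expr k)) (obj cand_expr))
         (Seq (Assign (cand k) (Cell 26)) (Assign (cand (k + 2)) (Cell 27))) Skip))"

fun copy :: "nat \<Rightarrow> prog" where
  "copy 0 = Skip"
| "copy (Suc k) = Seq (copy k) (Assign (best k) (Cell (cand k)))"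

text \<open>The loop counters are the candidate cells themselves, so the inner program finds its
  fixed coordinates already in place.\<close>

fun nest :: "nat list \<Rightarrow> prog \<Rightarrow> prog" where
  "nest [] p = p"
| "nest (k # ks) p = For 25 (cand k) (nest ks p)"

fun emit :: "nat \<Rightarrow> prog" where
  "emit 0 = Skip"
| "emit (Suc k) = Seq (emit k)
     (Assign k (Sub (Add (Mul (Const 2) (Cell (best k))) (Const 1)) (Cell 25)))"

definition improve :: "((nat \<Rightarrow> expr) \<Rightarrow> expr) \<Rightarrow> prog" where
  "improve obj = Seq (block obj 0) (Seq (block obj 1)
     (Cond (Less (obj cand_expr) (obj best_expr)) (copy 8) Skip))"

text \<open>Unwritten cells are 0, so the candidate and the best vector start as the digit vector 0.\<close>

definition decoder :: "((nat \<Rightarrow> expr) \<Rightarrow> expr) \<Rightarrow> prog" where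
  "decoder obj = Seq (Assign 25 (Sqrt (Cell 0))) (Seq (nest [4, 5, 6, 7] (improve obj)) (emit 8))"

lemma depth_copy [simp]: "depth (copy k) = 0"
  by (induction k) auto

lemma depth_emit [simp]: "depth (emit k) = 0"
  by (induction k) auto

text \<open>Four counters and the loop of a block; the two blocks run in sequence and contribute
  only once. The objective is an expression and has no loop.\<close>

lemma depth_decoder: "depth (decoder obj) = 5"
  by (simp add: decoder_def improve_def block_def slice_def For_def Let_def)

section \<open>Correctness of the search\<close>

definition digits :: "nat \<Rightarrow> real set" where
  "digits N = real ` {..<N}"

definition grid :: "nat \<Rightarrow> (nat \<Rightarrow> real) set" where
  "grid N = {u. \<forall>k<8. u k \<in> digits N}"

text \<open>\<open>inp\<close> is the memory once N has been stored in cell 25; the search preserves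
  it up to that cell. \<open>F_separable\<close> says that F is a sum of a function of coordinates
  0, 2 and one of coordinates 1, 3, as long as coordinates 4 to 7 are fixed. \<open>F_cong\<close>
  is there because vectors are functions on all of \<open>nat\<close>.\<close>

locale search =
  fixes N :: nat and inp :: memory and obj :: "(nat \<Rightarrow> expr) \<Rightarrow> expr" and F :: "(nat \<Rightarrow> real) \<Rightarrow> real"
  assumes N_pos: "0 < N"
    and inp_25: "inp 25 = real N"
    and obj: "\<And>m ce. (\<And>c. c \<le> 25 \<Longrightarrow> m c = inp c) \<Longrightarrow> (\<And>k. k < 8 \<Longrightarrow> defined (ce k) m) \<Longrightarrow>
      defined (obj ce) m \<and> eval (obj ce) m = F (\<lambda>k. eval (ce k) m)"
    and F_cong: "\<And>u v. (\<And>k. k < 8 \<Longrightarrow> u k = v k) \<Longrightarrow> F u = F v"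
    and F_nonneg: "\<And>u. 0 \<le> F u"
    and F_quadratic: "\<And>k u. k < 2 \<Longrightarrow> \<exists>a b c. \<forall>t. F (u(k := t)) = a * t\<^sup>2 + b * t + c"
    and F_separable: "\<And>u v. (\<And>k. 4 \<le> k \<Longrightarrow> k < 8 \<Longrightarrow> u k = v k) \<Longrightarrow>
      F u + F v = F (v(0 := u 0, 2 := u 2)) + F (v(1 := u 1, 3 := u 3))"
begin

definition good :: "memory \<Rightarrow> bool" where
  "good m \<longleftrightarrow> (\<forall>c\<le>25. m c = inp c)"

lemma good_update [simp]: "25 < c \<Longrightarrow> good (m(c := v)) = good m"
  by (auto simp: good_def)

lemma good_25: "good m \<Longrightarrow> m 25 = real N"
  using inp_25 by (simp add: good_def)

lemma
  assumes "good m" "\<And>k. k < 8 \<Longrightarrow> defined (ce k) m"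
  shows defined_obj: "defined (obj ce) m"
    and eval_obj: "eval (obj ce) m = F (\<lambda>k. eval (ce k) m)"
  using obj[of m ce] assms by (auto simp: good_def)

text \<open>The postcondition is required for every minimizing digit, so that a caller need not know
  which one the rounding yields.\<close>

lemma runs_slice:
  assumes m: "good m" and ce: "\<And>j. j < 8 \<Longrightarrow> defined (ce j) m"
    and k: "k < 2"
    and Q: "\<And>i. i < N \<Longrightarrow> (\<And>j. j < N \<Longrightarrow>
        F ((\<lambda>j. eval (ce j) m)(k := real i)) \<le> F ((\<lambda>j. eval (ce j) m)(k := real j))) \<Longrightarrow>
        Q (m(26 := real i))"
  shows "runs N (slice obj ce k) m Q"
proof -
  let ?v = "\<lambda>j. eval (ce j) m"
  let ?q = "\<lambda>t. obj (ce(k := Const t))"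
  let ?d = "Sub (Add (?q 1) (?q (-1))) (Mul (Const 2) (?q 0))"
  obtain a b c where abc: "\<And>t. F (?v(k := t)) = a * t\<^sup>2 + b * t + c"
    using F_quadratic[OF k] by metis
  have nonneg: "0 \<le> a * t\<^sup>2 + b * t + c" for t
    using F_nonneg abc by metis
  have q: "defined (?q t) m" "eval (?q t) m = a * (of_int t)\<^sup>2 + b * of_int t + c" for t
  proof -
    have d: "\<And>j. j < 8 \<Longrightarrow> defined ((ce(k := Const t)) j) m" using ce by simp
    show "defined (?q t) m" by (rule defined_obj[where ce = "ce(k := Const t)", OF m d])
    have "(\<lambda>j. eval ((ce(k := Const t)) j) m) = ?v(k := of_int t)" by auto
    then show "eval (?q t) m = a * (of_int t)\<^sup>2 + b * of_int t + c"
      using eval_obj[where ce = "ce(k := Const t)", OF m d] abc by simp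
  qed
  \<comment> \<open>\<open>r\<close> is left free when a = 0: the function is then constant and
    every digit is optimal.\<close>
  have final: "Q (m(26 := real_of_int (clip N r)))" if r: "a \<noteq> 0 \<Longrightarrow> r = round (- b / (2 * a))" for r
  proof -
    have i: "real (nat (clip N r)) = real_of_int (clip N r)" "nat (clip N r) < N"
      using N_pos by (auto simp: clip_def)
    have "Q (m(26 := real (nat (clip N r))))"
    proof (rule Q[OF i(2)])
      fix j assume "j < N"
      then show "F (?v(k := real (nat (clip N r)))) \<le> F (?v(k := real j))"
        unfolding abc i(1) using clip_minimizes_quadratic[OF nonneg _ r] by blast
    qed
    then show ?thesis by (simp only: i(1))
  qed
  have limit: "runs N (Cond (Less (Cell 26) (Const 0)) (Assign 26 (Const 0))
            (Cond (Less (Sub (Cell 25) (Const 1)) (Cell 26))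
               (Assign 26 (Sub (Cell 25) (Const 1))) Skip)) (m(26 := real_of_int r)) Q"
    if r: "a \<noteq> 0 \<Longrightarrow> r = round (- b / (2 * a))" for r
    using final[OF r] good_25[OF m]
    by (auto intro!: runs_Cond runs_Assign runs_Skip simp: clip_def split: if_splits)
  have d: "eval ?d m = 2 * a" by (simp add: q)
  \<comment> \<open>The numerator q(-1) - q(1) is -2 b and the denominator is twice the second
    difference 2 a, so the quotient is the vertex.\<close>
  have e: "(b * (-1) - b * 1) / (2 * (2 * a)) = - b / (2 * a)" by (cases "a = 0") (simp_all add: field_simps)
  have "runs N (Cond (Equal ?d (Const 0)) (Assign 26 (Const 0))
            (Assign 26 (Round (Div (Sub (?q (-1)) (?q 1)) (Mul (Const 2) ?d))))) m
        (\<lambda>m'. \<exists>r. (a \<noteq> 0 \<longrightarrow> r = round (- b / (2 * a))) \<and> m' = m(26 := real_of_int r))"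
  proof (intro runs_Cond runs_Assign)
    assume "\<not> holds (Equal ?d (Const 0)) m"
    then show "\<exists>r. (a \<noteq> 0 \<longrightarrow> r = round (- b / (2 * a))) \<and>
        m(26 := eval (Round (Div (Sub (?q (-1)) (?q 1)) (Mul (Const 2) ?d))) m) = m(26 := real_of_int r)"
      using d by (intro exI[of _ "round (- b / (2 * a))"]) (simp add: q field_simps)
  qed (use d in \<open>auto simp: q intro!: exI[of _ 0]\<close>)
  then show ?thesis
    unfolding slice_def Let_def
    by (intro runs_Seq) (erule runs_mono, use limit in blast)
qed

lemma runs_block:
  assumes k: "k < 2" and m: "good m" and digits: "\<And>j. j < 4 \<Longrightarrow> m (cand j) \<in> digits N"
  shows "runs N (block obj k) m (\<lambda>m'.
    (\<forall>c. c \<notin> {26, 27, cand k, cand (k + 2)} \<longrightarrow> m' c = m c) \<and>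
    m' (cand k) \<in> digits N \<and> m' (cand (k + 2)) \<in> digits N \<and>
    (\<forall>a\<in>digits N. \<forall>b\<in>digits N.
      F (\<lambda>j. m' (cand j)) \<le> F ((\<lambda>j. m (cand j))(k := a, k + 2 := b))))"
proof -
  let ?u = "\<lambda>a b. (\<lambda>j. m (cand j))(k := a, k + 2 := b)"
  \<comment> \<open>Trials are measured against the vector \<open>?u\<close> built from the memory
    on entry. The quantifier over \<open>a\<close> is discharged by slicing, the one over
    \<open>j\<close> by the passes already made.\<close>
  define I where "I = (\<lambda>i m'. m' 27 = real i \<and>
    (\<forall>c. c \<notin> {26, 27, cand k, cand (k + 2)} \<longrightarrow> m' c = m c) \<and>
    m' (cand k) \<in> digits N \<and> m' (cand (k + 2)) \<in> digits N \<and>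
    (\<forall>a\<in>digits N. \<forall>j<i. F (\<lambda>j. m' (cand j)) \<le> F (?u a (real j))))"
  have I_good: "good m'" if "I i m'" for i m'
    using that m by (auto simp: I_def good_def cand_def)
  show ?thesis
    unfolding block_def
  proof (rule runs_For[where I = I])
    show "I 0 (m(27 := 0))"
      using digits k by (auto simp: I_def)
    show "m' 27 = real i \<and> m' 25 = real N" if "I i m'" for i m'
      using good_25[OF I_good[OF that]] that by (simp add: I_def)
    show "runs N (Seq (slice obj (trial_expr k) k)
         (Cond (Less (obj (trial_expr k)) (obj cand_expr))
           (Seq (Assign (cand k) (Cell 26)) (Assign (cand (k + 2)) (Cell 27))) Skip)) m1
         (\<lambda>m'. m' 27 = real i \<and> I (Suc i) (m'(27 := real (Suc i))))"
      if i: "i < N" and I: "I i m1" for i m1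
    proof (rule runs_Seq, rule runs_slice)
      show g: "good m1" by (rule I_good[OF I])
      show "defined (trial_expr k j) m1" for j
        by (simp add: trial_expr_def cand_expr_def)
      show "k < 2" by (rule k)
      fix l assume l: "l < N" and min: "\<And>j. j < N \<Longrightarrow>
        F ((\<lambda>j. eval (trial_expr k j) m1)(k := real l)) \<le> F ((\<lambda>j. eval (trial_expr k j) m1)(k := real j))"
      have u: "(\<lambda>j. eval (trial_expr k j) m1)(k := t) = ?u t (real i)" for t
        using I by (auto simp: trial_expr_def cand_expr_def I_def fun_eq_iff)
      have min': "F (?u (real l) (real i)) \<le> F (?u a (real i))" if "a \<in> digits N" for a
        using min that unfolding u by (auto simp: digits_def)
      let ?m = "m1(26 := real l)"
      have g': "good ?m" using g by simp
      have t1: "(\<lambda>j. eval (trial_expr k j) ?m) = ?u (real l) (real i)"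
        using I by (auto simp: trial_expr_def cand_expr_def I_def fun_eq_iff)
      have t2: "(\<lambda>j. eval (cand_expr j) ?m) = (\<lambda>j. m1 (cand j))"
        by (simp add: cand_expr_def)
      have d: "defined (trial_expr k j) ?m" "defined (cand_expr j) ?m" for j
        by (simp_all add: trial_expr_def cand_expr_def)
      note ev = eval_obj[where ce = "trial_expr k", OF g' d(1), unfolded t1]
        eval_obj[where ce = cand_expr, OF g' d(2), unfolded t2]
      show "runs N (Cond (Less (obj (trial_expr k)) (obj cand_expr))
           (Seq (Assign (cand k) (Cell 26)) (Assign (cand (k + 2)) (Cell 27))) Skip) ?m
         (\<lambda>m'. m' 27 = real i \<and> I (Suc i) (m'(27 := real (Suc i))))"
      proof (rule runs_Cond)
        show "test_defined (Less (obj (trial_expr k)) (obj cand_expr)) ?m"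
          using defined_obj[where ce = "trial_expr k", OF g' d(1)]
            defined_obj[where ce = cand_expr, OF g' d(2)] by simp
      next
        assume "holds (Less (obj (trial_expr k)) (obj cand_expr)) ?m"
        then have less: "F (?u (real l) (real i)) < F (\<lambda>j. m1 (cand j))"
          by (simp add: ev)
        have eq: "(\<lambda>j. (?m(cand k := real l, cand (k + 2) := real i, 27 := real (Suc i))) (cand j)) =
            ?u (real l) (real i)"
          using I by (auto simp: I_def fun_eq_iff)
        have "I (Suc i) (?m(cand k := real l, cand (k + 2) := real i, 27 := real (Suc i)))"
          unfolding I_def eq
        proof (intro conjI ballI allI impI)
          fix a j assume a: "a \<in> digits N" and j: "j < Suc i"
          show "F (?u (real l) (real i)) \<le> F (?u a (real j))"
          proof (cases "j = i")
            case False
            then have "F (\<lambda>j. m1 (cand j)) \<le> F (?u a (real j))"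
              using I a j by (simp add: I_def)
            then show ?thesis using less by linarith
          qed (use min' a in simp)
        qed (use I l i in \<open>auto simp: I_def digits_def\<close>)
        then show "runs N (Seq (Assign (cand k) (Cell 26)) (Assign (cand (k + 2)) (Cell 27))) ?m
           (\<lambda>m'. m' 27 = real i \<and> I (Suc i) (m'(27 := real (Suc i))))"
          using I by (auto intro!: runs_Seq runs_Assign simp: I_def)
      next
        assume "\<not> holds (Less (obj (trial_expr k)) (obj cand_expr)) ?m"
        then have le: "F (\<lambda>j. m1 (cand j)) \<le> F (?u (real l) (real i))"
          by (simp add: ev)
        have eq: "(\<lambda>j. (?m(27 := real (Suc i))) (cand j)) = (\<lambda>j. m1 (cand j))"
          by simp
        have "I (Suc i) (?m(27 := real (Suc i)))"
          unfolding I_def eq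
        proof (intro conjI ballI allI impI)
          fix a j assume a: "a \<in> digits N" and j: "j < Suc i"
          show "F (\<lambda>j. m1 (cand j)) \<le> F (?u a (real j))"
          proof (cases "j = i")
            case True
            then show ?thesis using le min'[OF a] by simp
          next
            case False
            then show ?thesis using I a j by (simp add: I_def)
          qed
        qed (use I in \<open>auto simp: I_def\<close>)
        then show "runs N Skip ?m (\<lambda>m'. m' 27 = real i \<and> I (Suc i) (m'(27 := real (Suc i))))"
          using I by (auto intro!: runs_Skip simp: I_def)
      qed
    qed
  qed (auto simp: I_def digits_def)
qed

text \<open>The cells read and the cells written are disjoint, so the sequence of assignments acts
  as a simultaneous one. \<open>THE\<close> recovers the index from the address.\<close>

lemma runs_copy:
  "runs N (copy k) m (\<lambda>m'. m' = (\<lambda>c. if \<exists>j<k. c = best j then m (cand (THE j. c = best j)) else m c))"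
proof (induction k)
  case 0
  then show ?case by (auto intro: runs_Skip)
next
  case (Suc k)
  show ?case
    unfolding copy.simps
    by (rule runs_Seq, rule runs_mono[OF Suc], rule runs_Assign)
      (auto simp: fun_eq_iff less_Suc_eq)
qed

text \<open>\<open>S\<close> collects the vectors already known to be no better than the stored best
  one. Candidate coordinates 0 to 3 must remain digits, being incumbents of the next blocks;
  coordinates 4 to 7 are loop counters, which reach N on exit and then are not digits.\<close>

definition best_of :: "(nat \<Rightarrow> real) set \<Rightarrow> memory \<Rightarrow> bool" where
  "best_of S m \<longleftrightarrow> good m \<and> (\<forall>k<4. m (cand k) \<in> digits N) \<and> (\<forall>k<8. m (best k) \<in> digits N) \<and>
     (\<forall>u\<in>S. F (\<lambda>k. m (best k)) \<le> F u)"

lemma best_of_update [simp]: "4 \<le> k \<Longrightarrow> best_of S (m(cand k := v)) = best_of S m"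
  by (auto simp: best_of_def)

text \<open>This is where separability replaces a joint search over symbols 1 and 2: the second
  block starts from the result of the first, and the exchange identity turns the two partial optima
  into a joint one.\<close>

lemma runs_improve:
  assumes m: "best_of S m" and digits: "\<And>k. 4 \<le> k \<Longrightarrow> k < 8 \<Longrightarrow> m (cand k) \<in> digits N"
  shows "runs N (improve obj) m (\<lambda>m'. (\<forall>k\<in>{4..<8}. m' (cand k) = m (cand k)) \<and>
    best_of (S \<union> {u \<in> grid N. \<forall>k\<in>{4..<8}. u k = m (cand k)}) m')"
  unfolding improve_def
proof (rule runs_Seq, rule runs_mono[OF runs_block[where k = 0, unfolded add_0]])
  let ?T = "{u \<in> grid N. \<forall>k\<in>{4..<8}. u k = m (cand k)}"
  show "0 < (2::nat)" "good m" "\<And>j. j < 4 \<Longrightarrow> m (cand j) \<in> digits N"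
    using m by (auto simp: best_of_def)
  fix m1
  assume m1: "(\<forall>c. c \<notin> {26, 27, cand 0, cand 2} \<longrightarrow> m1 c = m c) \<and>
    m1 (cand 0) \<in> digits N \<and> m1 (cand 2) \<in> digits N \<and>
    (\<forall>a\<in>digits N. \<forall>b\<in>digits N. F (\<lambda>j. m1 (cand j)) \<le> F ((\<lambda>j. m (cand j))(0 := a, 2 := b)))"
  have frame1: "m1 c = m c" if "c \<notin> {26, 27, cand 0, cand 2}" for c
    using m1 that by simp
  have g1: "good m1" using m frame1 by (auto simp: good_def best_of_def cand_def)
  have dig1: "m1 (cand j) \<in> digits N" if "j < 4" for j
    using m1 m that frame1[of "cand j"] by (cases "j = 0 \<or> j = 2") (auto simp: best_of_def)
  have 3: "(1::nat) + 2 = 3" by simp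
  show "runs N (Seq (block obj 1) (Cond (Less (obj cand_expr) (obj best_expr)) (copy 8) Skip)) m1
    (\<lambda>m'. (\<forall>k\<in>{4..<8}. m' (cand k) = m (cand k)) \<and> best_of (S \<union> ?T) m')"
  proof (rule runs_Seq, rule runs_mono[OF runs_block[OF _ g1 dig1, where k = 1, unfolded 3]])
    fix m2
    assume m2: "(\<forall>c. c \<notin> {26, 27, cand 1, cand 3} \<longrightarrow> m2 c = m1 c) \<and>
      m2 (cand 1) \<in> digits N \<and> m2 (cand 3) \<in> digits N \<and>
      (\<forall>a\<in>digits N. \<forall>b\<in>digits N. F (\<lambda>j. m2 (cand j)) \<le> F ((\<lambda>j. m1 (cand j))(1 := a, 3 := b)))"
    have frame2: "m2 c = m1 c" if "c \<notin> {26, 27, cand 1, cand 3}" for c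
      using m2 that by simp
    have g2: "good m2" using g1 frame2 by (auto simp: good_def cand_def)
    have dig2: "m2 (cand j) \<in> digits N" if "j < 4" for j
      using m2 dig1 that frame2[of "cand j"] by (cases "j = 1 \<or> j = 3") auto
    have cand2: "m2 (cand k) = m (cand k)" if "4 \<le> k" for k
      using that frame1[of "cand k"] frame2[of "cand k"] by simp
    have best2: "m2 (best k) = m (best k)" for k
      using frame1[of "best k"] frame2[of "best k"] by simp
    have opt: "F (\<lambda>k. m2 (cand k)) \<le> F u" if u: "u \<in> ?T" for u
    proof -
      let ?v = "\<lambda>k. m1 (cand k)"
      have agree: "u k = m1 (cand k)" if "4 \<le> k" "k < 8" for k
        using u that frame1[of "cand k"] by auto
      have du: "u k \<in> digits N" if "k < 8" for k
        using u that by (simp add: grid_def)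
      have "F ?v \<le> F ((\<lambda>j. m (cand j))(0 := u 0, 2 := u 2))"
        using m1 du[of 0] du[of 2] by simp
      \<comment> \<open>The first block touched only coordinates 0 and 2, which are overridden on
        both sides.\<close>
      also have "(\<lambda>j. m (cand j))(0 := u 0, 2 := u 2) = ?v(0 := u 0, 2 := u 2)"
        using frame1 by (auto simp: fun_eq_iff)
      finally have "F ?v \<le> F (?v(0 := u 0, 2 := u 2))" .
      moreover have "F (\<lambda>k. m2 (cand k)) \<le> F (?v(1 := u 1, 3 := u 3))"
        using m2 du[of 1] du[of 3] by simp
      \<comment> \<open>The first summand on the right is at least F v, hence F u is at least the
        second one, which the second block has bounded from below.\<close>
      moreover have "F u + F ?v = F (?v(0 := u 0, 2 := u 2)) + F (?v(1 := u 1, 3 := u 3))"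
        by (rule F_separable) (use agree in auto)
      ultimately show ?thesis by linarith
    qed
    have d: "defined (cand_expr j) m2" "defined (best_expr j) m2" for j
      by (simp_all add: cand_expr_def best_expr_def)
    have ev: "eval (obj cand_expr) m2 = F (\<lambda>k. m2 (cand k))"
      "eval (obj best_expr) m2 = F (\<lambda>k. m (best k))"
      using eval_obj[where ce = cand_expr, OF g2 d(1)] eval_obj[where ce = best_expr, OF g2 d(2)] by (simp_all add: cand_expr_def best_expr_def best2)
    show "runs N (Cond (Less (obj cand_expr) (obj best_expr)) (copy 8) Skip) m2
      (\<lambda>m'. (\<forall>k\<in>{4..<8}. m' (cand k) = m (cand k)) \<and> best_of (S \<union> ?T) m')"
    proof (rule runs_Cond)
      show "test_defined (Less (obj cand_expr) (obj best_expr)) m2"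
        using defined_obj[where ce = cand_expr, OF g2 d(1)] defined_obj[where ce = best_expr, OF g2 d(2)] by simp
    next
      assume "holds (Less (obj cand_expr) (obj best_expr)) m2"
      then have less: "F (\<lambda>k. m2 (cand k)) < F (\<lambda>k. m (best k))"
        by (simp add: ev)
      show "runs N (copy 8) m2
        (\<lambda>m'. (\<forall>k\<in>{4..<8}. m' (cand k) = m (cand k)) \<and> best_of (S \<union> ?T) m')"
      proof (rule runs_mono[OF runs_copy])
        fix m3
        assume m3: "m3 = (\<lambda>c. if \<exists>j<8. c = best j then m2 (cand (THE j. c = best j)) else m2 c)"
        have c3: "m3 (cand k) = m2 (cand k)" for k by (simp add: m3)
        have b3: "m3 (best k) = m2 (cand k)" if "k < 8" for k using that by (simp add: m3)
        have g3: "good m3" using g2 by (auto simp: good_def m3 best_def)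
        have eq: "F (\<lambda>k. m3 (best k)) = F (\<lambda>k. m2 (cand k))"
          by (rule F_cong) (use b3 in simp)
        have dig3: "m3 (best k) \<in> digits N" if "k < 8" for k
          using b3[OF that] dig2[of k] cand2[of k] digits[of k] that by (cases "k < 4") auto
        show "(\<forall>k\<in>{4..<8}. m3 (cand k) = m (cand k)) \<and> best_of (S \<union> ?T) m3"
        proof (intro conjI ballI)
          show "best_of (S \<union> ?T) m3"
            unfolding best_of_def eq
          proof (intro conjI ballI allI impI)
            fix u assume "u \<in> S \<union> ?T"
            then have "F (\<lambda>k. m (best k)) \<le> F u \<or> F (\<lambda>k. m2 (cand k)) \<le> F u"
              using m opt by (auto simp: best_of_def)
            then show "F (\<lambda>k. m2 (cand k)) \<le> F u" using less by linarith
          qed (use g3 dig3 dig2 c3 in auto)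
        qed (use c3 cand2 in auto)
      qed
    next
      assume "\<not> holds (Less (obj cand_expr) (obj best_expr)) m2"
      then have "F (\<lambda>k. m (best k)) \<le> F (\<lambda>k. m2 (cand k))"
        by (simp add: ev)
      then have "best_of (S \<union> ?T) m2"
        unfolding best_of_def best2 using g2 dig2 order_trans[OF _ opt] m
        by (auto simp: best_of_def)
      then show "runs N Skip m2
        (\<lambda>m'. (\<forall>k\<in>{4..<8}. m' (cand k) = m (cand k)) \<and> best_of (S \<union> ?T) m')"
        using cand2 by (auto intro!: runs_Skip)
    qed
  qed simp_all
qed

lemma runs_nest:
  assumes "distinct ks" "set ks \<subseteq> {4..<8}" "best_of S m"
    and "\<And>k. k \<in> {4..<8} - set ks \<Longrightarrow> m (cand k) \<in> digits N"
  shows "runs N (nest ks (improve obj)) m (\<lambda>m'.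
    (\<forall>k\<in>{4..<8} - set ks. m' (cand k) = m (cand k)) \<and>
    best_of (S \<union> {u \<in> grid N. \<forall>k\<in>{4..<8} - set ks. u k = m (cand k)}) m')"
  using assms
proof (induction ks arbitrary: S m)
  case Nil
  then show ?case using runs_improve[of S m] by simp
next
  case (Cons k ks)
  let ?D = "{4..<8} - set (k # ks)"
  have k: "4 \<le> k" "k < 8" "k \<notin> set ks" using Cons.prems by auto
  have D: "{4..<8} - set ks = insert k ?D" using k by auto
  \<comment> \<open>\<open>T i\<close> is the part of the target set swept by the first
    \<open>i\<close> passes of the outermost loop; one more pass adds the layer on which coordinate
    \<open>k\<close> equals \<open>i\<close>.\<close>
  define T where "T = (\<lambda>i. {u \<in> grid N. (\<forall>j\<in>?D. u j = m (cand j)) \<and> u k < real i})"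
  define I where "I = (\<lambda>i m'. m' (cand k) = real i \<and> (\<forall>j\<in>?D. m' (cand j) = m (cand j)) \<and>
    best_of (S \<union> T i) m')"
  show ?case
    unfolding nest.simps
  proof (rule runs_For[where I = I])
    have "T 0 = {}" using k by (auto simp: T_def grid_def digits_def)
    then show "I 0 (m(cand k := 0))"
      using Cons.prems k by (auto simp: I_def)
    show "m' (cand k) = real i \<and> m' 25 = real N" if "I i m'" for i m'
      using that good_25 by (auto simp: I_def best_of_def)
    show "runs N (nest ks (improve obj)) m1
        (\<lambda>m'. m' (cand k) = real i \<and> I (Suc i) (m'(cand k := real (Suc i))))"
      if i: "i < N" and I: "I i m1" for i m1
    proof (rule runs_mono[OF Cons.IH[of "S \<union> T i" m1]])
      show "distinct ks" "set ks \<subseteq> {4..<8}" "best_of (S \<union> T i) m1"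
        using Cons.prems I by (auto simp: I_def)
      show "m1 (cand j) \<in> digits N" if "j \<in> {4..<8} - set ks" for j
        using that Cons.prems(4)[of j] I i unfolding D by (auto simp: I_def digits_def)
      fix m2
      assume m2: "(\<forall>k\<in>{4..<8} - set ks. m2 (cand k) = m1 (cand k)) \<and>
        best_of (S \<union> T i \<union> {u \<in> grid N. \<forall>k\<in>{4..<8} - set ks. u k = m1 (cand k)}) m2"
      have "T i \<union> {u \<in> grid N. \<forall>k\<in>{4..<8} - set ks. u k = m1 (cand k)} = T (Suc i)"
        using I k unfolding D by (auto simp: T_def I_def grid_def digits_def less_Suc_eq)
      then have "best_of (S \<union> T (Suc i)) m2"
        using m2 by (metis Un_assoc)
      moreover have "m2 (cand k) = real i" "\<forall>j\<in>?D. m2 (cand j) = m (cand j)"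
        using m2 I unfolding D by (auto simp: I_def)
      ultimately show "m2 (cand k) = real i \<and> I (Suc i) (m2(cand k := real (Suc i)))"
        using k by (auto simp: I_def)
    qed
    fix m1 assume I: "I N m1"
    have "T N = {u \<in> grid N. \<forall>j\<in>?D. u j = m (cand j)}"
      using k by (auto simp: T_def grid_def digits_def)
    then show "(\<forall>k\<in>?D. m1 (cand k) = m (cand k)) \<and>
      best_of (S \<union> {u \<in> grid N. \<forall>j\<in>?D. u j = m (cand j)}) m1"
      using I by (simp add: I_def)
  qed
qed

text \<open>The output overwrites the input, but with k at most 25 it reaches neither cell 25 nor a
  best digit, which are all that is still read.\<close>

lemma runs_emit:
  "k \<le> 25 \<Longrightarrow> runs N (emit k) m (\<lambda>m'. m' =
     (\<lambda>c. if c < k then 2 * m (best c) + 1 - m 25 else m c))"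
proof (induction k)
  case 0
  then show ?case by (auto intro: runs_Skip)
next
  case (Suc k)
  have "k \<le> 25" using Suc.prems by simp
  have b: "\<not> best k < k" by (simp add: best_def)
  show ?case
    unfolding emit.simps
    by (rule runs_Seq, rule runs_mono[OF Suc.IH[OF \<open>k \<le> 25\<close>]], rule runs_Assign)
      (use Suc.prems b in \<open>auto simp: fun_eq_iff less_Suc_eq\<close>)
qed

lemma runs_decoder:
  assumes inp: "inp = m(25 := real N)" and m: "m 0 = (real N)\<^sup>2" "\<And>c. 25 < c \<Longrightarrow> m c = 0"
  shows "runs N (decoder obj) m (\<lambda>m'. \<exists>v\<in>grid N. (\<forall>u\<in>grid N. F v \<le> F u) \<and>
    (\<forall>k<8. m' k = 2 * v k + 1 - real N))"
proof -
  have "best_of {} (m(25 := real N))"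
    unfolding best_of_def good_def using N_pos m(2) inp by (auto simp: digits_def)
  then have "runs N (nest [4, 5, 6, 7] (improve obj)) (m(25 := real N))
      (\<lambda>m'. best_of ({} \<union> {u \<in> grid N. \<forall>k\<in>{4..<8} - set [4, 5, 6, 7]. u k = (m(25 := real N)) (cand k)}) m')"
    by (intro runs_mono[OF runs_nest]) (use N_pos m(2) in \<open>auto simp: digits_def\<close>)
  moreover have "{4..<8} - set [4, 5, 6, 7] = ({} :: nat set)"
    by auto
  ultimately have "runs N (nest [4, 5, 6, 7] (improve obj)) (m(25 := real N)) (best_of (grid N))"
    by simp
  then have "runs N (Seq (nest [4, 5, 6, 7] (improve obj)) (emit 8)) (m(25 := real N)) (\<lambda>m'.
      \<exists>v\<in>grid N. (\<forall>u\<in>grid N. F v \<le> F u) \<and> (\<forall>k<8. m' k = 2 * v k + 1 - real N))"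
  proof (rule runs_Seq[OF runs_mono])
    fix m1 assume m1: "best_of (grid N) m1"
    show "runs N (emit 8) m1 (\<lambda>m'. \<exists>v\<in>grid N. (\<forall>u\<in>grid N. F v \<le> F u) \<and>
        (\<forall>k<8. m' k = 2 * v k + 1 - real N))"
      by (rule runs_mono[OF runs_emit], simp, rule bexI[of _ "\<lambda>k. m1 (best k)"])
        (use m1 good_25 in \<open>auto simp: best_of_def grid_def\<close>)
  qed
  then show ?thesis
    unfolding decoder_def by (intro runs_Seq[of N "Assign _ _"] runs_Assign) (simp_all add: m(1) del: nest.simps)
qed

end

subsection \<open>Complex expressions\<close>

definition computes :: "memory \<Rightarrow> expr \<times> expr \<Rightarrow> complex \<Rightarrow> bool" where
  "computes m e z \<longleftrightarrow> defined (fst e) m \<and> defined (snd e) m \<and> Complex (eval (fst e) m) (eval (snd e) m) = z"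

definition add_expr :: "expr \<times> expr \<Rightarrow> expr \<times> expr \<Rightarrow> expr \<times> expr" where
  "add_expr e f = (Add (fst e) (fst f), Add (snd e) (snd f))"

definition sub_expr :: "expr \<times> expr \<Rightarrow> expr \<times> expr \<Rightarrow> expr \<times> expr" where
  "sub_expr e f = (Sub (fst e) (fst f), Sub (snd e) (snd f))"

definition mul_expr :: "expr \<times> expr \<Rightarrow> expr \<times> expr \<Rightarrow> expr \<times> expr" where
  "mul_expr e f =
    (Sub (Mul (fst e) (fst f)) (Mul (snd e) (snd f)), Add (Mul (fst e) (snd f)) (Mul (snd e) (fst f)))"

definition input_expr :: "nat \<Rightarrow> expr \<times> expr" where
  "input_expr c = (Cell c, Cell (Suc c))"

lemma computes_arith:
  assumes "computes m e z" "computes m f w"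
  shows "computes m (add_expr e f) (z + w)" "computes m (sub_expr e f) (z - w)"
    "computes m (mul_expr e f) (z * w)"
  using assms by (auto simp: computes_def add_expr_def sub_expr_def mul_expr_def complex_eq_iff)

definition cos_expr :: "expr \<times> expr" where
  "cos_expr = (Sqrt (Div (Add (Const 1) (Div (Const 1) (Sqrt (Const 5)))) (Const 2)), Const 0)"

definition sin_expr :: "expr \<times> expr" where
  "sin_expr = (Sqrt (Div (Sub (Const 1) (Div (Const 1) (Sqrt (Const 5)))) (Const 2)), Const 0)"

lemma theta_bounds: "0 < theta" "theta < pi / 4"
  using arctan_ubound[of 2] arctan_less_iff[of 0 2] by (simp_all add: theta_def)

text \<open>The angle 2 theta is arctan 2, and cos (arctan x) = 1 / sqrt (1 + x^2). The half-angle
  formulas then express cos theta and sin theta by square roots of integers; the bounds on theta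
  select the nonnegative roots.\<close>

lemma cos_2_theta: "cos (2 * theta) = 1 / sqrt 5"
  by (simp add: theta_def cos_arctan)

lemma cos_theta: "cos theta = sqrt ((1 + 1 / sqrt 5) / 2)"
proof (rule real_sqrt_unique[symmetric])
  show "(cos theta)\<^sup>2 = (1 + 1 / sqrt 5) / 2"
    using cos_double_cos[of theta] cos_2_theta by simp
  show "0 \<le> cos theta"
    using theta_bounds by (intro cos_ge_zero) auto
qed

lemma sin_theta: "sin theta = sqrt ((1 - 1 / sqrt 5) / 2)"
proof (rule real_sqrt_unique[symmetric])
  show "(sin theta)\<^sup>2 = (1 - 1 / sqrt 5) / 2"
    using cos_double_sin[of theta] cos_2_theta by simp
  show "0 \<le> sin theta"
    using theta_bounds by (intro sin_ge_zero) auto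
qed

lemma computes_constants:
  "computes m cos_expr cth" "computes m sin_expr sth"
  by (simp_all add: computes_def cos_expr_def sin_expr_def cos_theta sin_theta complex_eq_iff)

text \<open>The same expression must work in every memory: these are the constants that a program
  can produce from integer literals.\<close>

definition computable :: "complex \<Rightarrow> bool" where
  "computable z \<longleftrightarrow> (\<exists>e. \<forall>m. computes m e z)"

lemma computable_arith:
  assumes "computable z" "computable w"
  shows "computable (z + w)" "computable (z - w)" "computable (z * w)"
  using assms computes_arith unfolding computable_def by meson+

lemma computable_constants:
  "computable 1" "computable (-1)" "computable \<i>" "computable (- \<i>)"
  "computable cth" "computable sth" "computable phi"
proof -
  have int: "computable (Complex (of_int a) (of_int b))" for a b
    unfolding computable_def computes_def by (intro exI[of _ "(Const a, Const b)"]) simp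
  show "computable 1" "computable (-1)" "computable \<i>" "computable (- \<i>)"
    using int[of 1 0] int[of "-1" 0] int[of 0 1] int[of 0 "-1"]
    by (simp_all add: complex_eq_iff one_complex.code[symmetric] imaginary_unit.code[symmetric] Complex_eq)
  show "computable cth" "computable sth"
    using computes_constants unfolding computable_def by blast+
  have "phi = Complex (sqrt 2 / 2) (sqrt 2 / 2)"
    by (simp add: phi_def exp_Euler cos_of_real sin_of_real cos_45 sin_45 complex_eq_iff flip: of_real_divide)
  then show "computable phi"
    unfolding computable_def computes_def
    by (intro exI[of _ "(Div (Sqrt (Const 2)) (Const 2), Div (Sqrt (Const 2)) (Const 2))"]) simp
qed

subsection \<open>The golden code\<close>

text \<open>The common form of the three codes: \<open>z1\<close> to \<open>z4\<close> are the
  entries of Psi x, and the variants differ only in the four constant factors. Each row couples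
  \<open>z1\<close> with \<open>z3\<close> or \<open>z2\<close> with \<open>z4\<close>.\<close>

definition golden :: "complex \<Rightarrow> complex \<Rightarrow> complex \<Rightarrow> complex \<Rightarrow> channel \<Rightarrow> complex^4 \<Rightarrow> complex^4" where
  "golden p1 p2 p3 p4 h x =
    (let z1 = cth * x $ 1 + sth * x $ 2; z2 = cth * x $ 2 - sth * x $ 1;
         z3 = cth * x $ 3 + sth * x $ 4; z4 = cth * x $ 4 - sth * x $ 3 in
     vector [p1 * h 1 1 1 * z1 + p3 * h 2 1 1 * z3,
             p2 * h 2 1 2 * z2 + p4 * h 1 1 2 * z4,
             p1 * h 1 2 1 * z1 + p3 * h 2 2 1 * z3,
             p2 * h 2 2 2 * z2 + p4 * h 1 2 2 * z4])"

lemma vec4_eq_iff: "x = y \<longleftrightarrow> x $ 1 = y $ 1 \<and> x $ 2 = y $ 2 \<and> x $ 3 = y $ 3 \<and> x $ 4 = y $ (4 :: 4)"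
  by (simp add: vec_eq_iff forall_4)

lemma vector_4 [simp]:
  "(vector [a, b, c, d] :: 'a::zero^4) $ 1 = a" "(vector [a, b, c, d] :: 'a::zero^4) $ 2 = b"
  "(vector [a, b, c, d] :: 'a::zero^4) $ 3 = c" "(vector [a, b, c, d] :: 'a::zero^4) $ 4 = d"
  by (simp_all add: vector_def)

lemma Psi_mult: "Psi *v x = vector [cth * x $ 1 + sth * x $ 2, cth * x $ 2 - sth * x $ 1,
    cth * x $ 3 + sth * x $ 4, cth * x $ 4 - sth * x $ 3]"
  by (simp add: vec4_eq_iff Psi_def matrix_vector_mult_def sum_4)

lemma diag_mat_mult: "diag_mat d *v x = (\<chi> i. d $ i * x $ i)"
  for d :: "'a::semiring_1^'n"
  by (simp add: vec_eq_iff diag_mat_def matrix_vector_mult_def if_distrib if_distribR sum.delta cong: if_cong)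

lemma dayal_varanasi_mult: "dayal_varanasi h *v x = golden 1 1 phi phi h x"
  unfolding dayal_varanasi_def matrix_vector_mul_assoc[symmetric] Psi_mult golden_def Let_def
  by (simp add: vec4_eq_iff matrix_vector_mult_def sum_4)

lemma belfiore_rekaya_viterbo_mult: "belfiore_rekaya_viterbo h *v x =
    golden (cth - sth * \<i>) (sth + cth * \<i>) (cth - sth * \<i>) (\<i> * (sth + cth * \<i>)) h x"
  unfolding belfiore_rekaya_viterbo_def matrix_vector_mul_assoc[symmetric] Psi_mult diag_mat_mult golden_def Let_def
  by (simp add: vec4_eq_iff matrix_vector_mult_def sum_4 mult.commute mult.left_commute)

lemma wimax_mult: "wimax h *v x = golden 1 (- \<i>) 1 (-1) h x"
  unfolding wimax_def matrix_vector_mul_assoc[symmetric] Psi_mult golden_def Let_def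
  by (simp add: vec4_eq_iff matrix_vector_mult_def sum_4)

lemma golden_forms:
  assumes "H \<in> {dayal_varanasi, belfiore_rekaya_viterbo, wimax}"
  obtains p1 p2 p3 p4 where "computable p1" "computable p2" "computable p3" "computable p4"
    "\<And>h x. H h *v x = golden p1 p2 p3 p4 h x"
proof -
  consider "H = dayal_varanasi" | "H = belfiore_rekaya_viterbo" | "H = wimax"
    using assms by blast
  then show thesis
  proof cases
    case 1
    show thesis
      by (rule that[of 1 1 phi phi]) (simp_all add: 1 dayal_varanasi_mult computable_constants)
  next
    case 2
    show thesis
      by (rule that[of "cth - sth * \<i>" "sth + cth * \<i>" "cth - sth * \<i>" "\<i> * (sth + cth * \<i>)"])
        (simp_all only: 2 belfiore_rekaya_viterbo_mult computable_constants computable_arith)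
  next
    case 3
    show thesis
      by (rule that[of 1 "- \<i>" 1 "-1"]) (simp_all add: 3 wimax_mult computable_constants)
  qed
qed

section \<open>Digit vectors and the QAM alphabet\<close>

definition symbols :: "nat \<Rightarrow> (nat \<Rightarrow> real) \<Rightarrow> complex^4" where
  "symbols N u = vector (map (\<lambda>k.
    Complex (2 * u (2 * k) + 1 - real N) (2 * u (2 * k + 1) + 1 - real N)) [0, 1, 2, 3])"

lemma pam_eq:
  assumes "sqrt (real M) = real N"
  shows "pam M = (\<lambda>t. 2 * t + 1 - real N) ` digits N"
proof -
  have "pam M = {2 * real k - 1 - real N | k. 1 \<le> k \<and> k \<le> N}"
    by (simp add: pam_def assms)
  also have "\<dots> = (\<lambda>t. 2 * t + 1 - real N) ` digits N"
  proof (intro set_eqI iffI)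
    fix x assume "x \<in> {2 * real k - 1 - real N | k. 1 \<le> k \<and> k \<le> N}"
    then obtain k where k: "x = 2 * real k - 1 - real N" "1 \<le> k" "k \<le> N" by blast
    then have "x = 2 * real (k - 1) + 1 - real N" "k - 1 < N" by auto
    then show "x \<in> (\<lambda>t. 2 * t + 1 - real N) ` digits N"
      by (auto simp: digits_def)
  next
    fix x assume "x \<in> (\<lambda>t. 2 * t + 1 - real N) ` digits N"
    then obtain i where "i < N" "x = 2 * real i + 1 - real N" by (auto simp: digits_def)
    then show "x \<in> {2 * real k - 1 - real N | k. 1 \<le> k \<and> k \<le> N}"
      by (auto intro!: exI[of _ "Suc i"])
  qed
  finally show ?thesis .
qed

lemma qam_iff: "z \<in> qam M \<longleftrightarrow> Re z \<in> pam M \<and> Im z \<in> pam M"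
  by (cases z) (auto simp: qam_def Complex_eq complex_eq_iff)

lemma symbols_grid:
  assumes "sqrt (real M) = real N"
  shows "{x. \<forall>i. x $ i \<in> qam M} = symbols N ` grid N"
proof (intro set_eqI iffI)
  fix x :: "complex^4" assume "x \<in> {x. \<forall>i. x $ i \<in> qam M}"
  then have x: "Re (x $ i) \<in> pam M" "Im (x $ i) \<in> pam M" for i
    by (auto simp: qam_iff)
  let ?l = "[Re (x $ 1), Im (x $ 1), Re (x $ 2), Im (x $ 2), Re (x $ 3), Im (x $ 3), Re (x $ 4), Im (x $ 4)]"
  \<comment> \<open>The inverse of t -> 2 t + 1 - N; its values from index 8 on are irrelevant to
    both \<open>symbols\<close> and \<open>grid\<close>.\<close>
  let ?u = "\<lambda>k. (?l ! k - 1 + real N) / 2"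
  have "x = symbols N ?u"
    by (simp add: symbols_def vec4_eq_iff complex_eq_iff field_simps)
  moreover have "(r - 1 + real N) / 2 \<in> digits N" if "r \<in> pam M" for r
    using that by (auto simp: pam_eq[OF assms])
  then have "?u \<in> grid N"
    using x by (simp add: grid_def eval_nat_numeral less_Suc_eq all_conj_distrib)
  ultimately show "x \<in> symbols N ` grid N" by blast
next
  fix x assume "x \<in> symbols N ` grid N"
  then show "x \<in> {x. \<forall>i. x $ i \<in> qam M}"
    by (auto simp: symbols_def grid_def forall_4 qam_iff pam_eq[OF assms])
qed

lemma norm_vec4: "(norm x)\<^sup>2 = (norm (x $ 1))\<^sup>2 + (norm (x $ 2))\<^sup>2 + (norm (x $ 3))\<^sup>2 + (norm (x $ 4))\<^sup>2"
  for x :: "complex^4"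
  by (simp add: norm_vec_def L2_set_def sum_4)

section \<open>Splitting into real and imaginary parts\<close>

definition objective :: "complex \<Rightarrow> complex \<Rightarrow> complex \<Rightarrow> complex \<Rightarrow>
    nat \<Rightarrow> channel \<Rightarrow> complex^4 \<Rightarrow> (nat \<Rightarrow> real) \<Rightarrow> real" where
  "objective p1 p2 p3 p4 N h y u = (norm (y - golden p1 p2 p3 p4 h (symbols N u)))\<^sup>2"

text \<open>As \<open>c\<close> and \<open>s\<close> are real, the bracket is A + i B with A
  depending on the real parts only and B on the imaginary parts only. In |w - k - g (A + i B)|^2 the
  products A B cancel, for the quadratic part is |g|^2 (A^2 + B^2).\<close>

lemma norm_separable:
  fixes w g k :: complex and c s :: real
  shows "(cmod (w - (g * (of_real c * Complex a b + of_real s * Complex a' b') + k)))\<^sup>2 +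
     (cmod (w - (g * (of_real c * Complex d e + of_real s * Complex d' e') + k)))\<^sup>2 =
     (cmod (w - (g * (of_real c * Complex a e + of_real s * Complex a' e') + k)))\<^sup>2 +
     (cmod (w - (g * (of_real c * Complex d b + of_real s * Complex d' b') + k)))\<^sup>2"
proof -
  have "(cmod (w - (g * (of_real c * Complex a b + of_real s * Complex a' b') + k)))\<^sup>2 =
      (Re (w - k) - (Re g * A - Im g * B))\<^sup>2 + (Im (w - k) - (Re g * B + Im g * A))\<^sup>2"
    if "A = c * a + s * a'" "B = c * b + s * b'" for a b a' b' A B
    unfolding cmod_power2 using that by (simp add: algebra_simps)
  note * = this[OF refl refl]
  show ?thesis
    unfolding * by (simp add: power2_eq_square algebra_simps)
qed

lemma objective_separable:
  assumes "\<And>k. 4 \<le> k \<Longrightarrow> k < 8 \<Longrightarrow> u k = v k"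
  shows "objective p1 p2 p3 p4 N h y u + objective p1 p2 p3 p4 N h y v =
    objective p1 p2 p3 p4 N h y (v(0 := u 0, 2 := u 2)) + objective p1 p2 p3 p4 N h y (v(1 := u 1, 3 := u 3))"
proof -
  have uv: "u 4 = v 4" "u 5 = v 5" "u 6 = v 6" "u 7 = v 7" using assms by auto
  let ?n = "\<lambda>u i. (cmod ((y - golden p1 p2 p3 p4 h (symbols N u)) $ i))\<^sup>2"
  note unfold = golden_def Let_def vector_minus_component vector_4 symbols_def list.map
  have 1: "?n u 1 + ?n v 1 = ?n (v(0 := u 0, 2 := u 2)) 1 + ?n (v(1 := u 1, 3 := u 3)) 1"
    unfolding unfold by (simp add: uv) (rule norm_separable)
  have 3: "?n u 3 + ?n v 3 = ?n (v(0 := u 0, 2 := u 2)) 3 + ?n (v(1 := u 1, 3 := u 3)) 3"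
    unfolding unfold by (simp add: uv) (rule norm_separable)
  have 2: "?n u 2 + ?n v 2 = ?n (v(0 := u 0, 2 := u 2)) 2 + ?n (v(1 := u 1, 3 := u 3)) 2"
    unfolding unfold
    \<comment> \<open>Here the rotation yields cos theta x2 - sin theta x1: symbols 1 and 2 trade
      roles and the sine changes sign.\<close>
    by (simp add: uv) (rule norm_separable[where s = "- sin theta", simplified])
  have 4: "?n u 4 + ?n v 4 = ?n (v(0 := u 0, 2 := u 2)) 4 + ?n (v(1 := u 1, 3 := u 3)) 4"
    unfolding unfold
    by (simp add: uv) (rule norm_separable[where s = "- sin theta", simplified])
  from 1 2 3 4 show ?thesis
    unfolding objective_def norm_vec4 by linarith
qed

section \<open>Quadratic dependence on a single digit\<close>

definition affine_fun :: "(real \<Rightarrow> complex) \<Rightarrow> bool" where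
  "affine_fun f \<longleftrightarrow> (\<exists>a b. \<forall>t. f t = a + of_real t * b)"

definition quadratic_fun :: "(real \<Rightarrow> real) \<Rightarrow> bool" where
  "quadratic_fun f \<longleftrightarrow> (\<exists>a b c. \<forall>t. f t = a * t\<^sup>2 + b * t + c)"

lemma affine_fun_const: "affine_fun (\<lambda>t. c)"
  unfolding affine_fun_def by (intro exI[of _ c] exI[of _ 0]) simp

lemma affine_fun_add: "affine_fun f \<Longrightarrow> affine_fun g \<Longrightarrow> affine_fun (\<lambda>t. f t + g t)"
  unfolding affine_fun_def
proof (elim exE)
  fix a b c d assume "\<forall>t. f t = a + of_real t * b" "\<forall>t. g t = c + of_real t * d"
  then show "\<exists>a b. \<forall>t. f t + g t = a + of_real t * b"
    by (intro exI[of _ "a + c"] exI[of _ "b + d"]) (simp add: algebra_simps)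
qed

lemma affine_fun_mult: "affine_fun f \<Longrightarrow> affine_fun (\<lambda>t. c * f t)"
  unfolding affine_fun_def
proof (elim exE)
  fix a b assume "\<forall>t. f t = a + of_real t * b"
  then show "\<exists>a b. \<forall>t. c * f t = a + of_real t * b"
    by (intro exI[of _ "c * a"] exI[of _ "c * b"]) (simp add: algebra_simps)
qed

lemma affine_fun_diff: "affine_fun f \<Longrightarrow> affine_fun g \<Longrightarrow> affine_fun (\<lambda>t. f t - g t)"
  using affine_fun_add[of f "\<lambda>t. - 1 * g t"] affine_fun_mult[of g "-1"] by simp

lemma affine_fun_symbols: "affine_fun (\<lambda>t. symbols N (u(k := t)) $ i)"
proof -
  have "affine_fun (\<lambda>t. Complex (2 * (u(k := t)) i + 1 - real N) (2 * (u(k := t)) j + 1 - real N))" for i j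
    unfolding affine_fun_def
    by (intro exI[of _ "Complex (2 * (u(k := 0)) i + 1 - real N) (2 * (u(k := 0)) j + 1 - real N)"]
         exI[of _ "Complex (if i = k then 2 else 0) (if j = k then 2 else 0)"]) (simp add: complex_eq_iff)
  then show ?thesis
    using exhaust_4[of i] unfolding symbols_def by (auto simp del: fun_upd_apply)
qed

lemma quadratic_fun_add: "quadratic_fun f \<Longrightarrow> quadratic_fun g \<Longrightarrow> quadratic_fun (\<lambda>t. f t + g t)"
  unfolding quadratic_fun_def
proof (elim exE)
  fix a b c d e k assume "\<forall>t. f t = a * t\<^sup>2 + b * t + c" "\<forall>t. g t = d * t\<^sup>2 + e * t + k"
  then show "\<exists>a b c. \<forall>t. f t + g t = a * t\<^sup>2 + b * t + c"
    by (intro exI[of _ "a + d"] exI[of _ "b + e"] exI[of _ "c + k"]) (simp add: algebra_simps)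
qed

lemma quadratic_fun_norm: "affine_fun f \<Longrightarrow> quadratic_fun (\<lambda>t. (cmod (f t))\<^sup>2)"
  unfolding affine_fun_def quadratic_fun_def
proof (elim exE)
  fix a b assume "\<forall>t. f t = a + of_real t * b"
  then show "\<exists>d e k. \<forall>t. (cmod (f t))\<^sup>2 = d * t\<^sup>2 + e * t + k"
    unfolding cmod_power2
    by (intro exI[of _ "(Re b)\<^sup>2 + (Im b)\<^sup>2"] exI[of _ "2 * (Re a * Re b + Im a * Im b)"]
         exI[of _ "(Re a)\<^sup>2 + (Im a)\<^sup>2"]) (simp add: power2_eq_square algebra_simps)
qed

lemma objective_quadratic: "quadratic_fun (\<lambda>t. objective p1 p2 p3 p4 N h y (u(k := t)))"
  unfolding objective_def golden_def Let_def norm_vec4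
  by (simp del: fun_upd_apply)
    (intro quadratic_fun_add quadratic_fun_norm affine_fun_add affine_fun_diff affine_fun_mult
      affine_fun_const affine_fun_symbols)

section \<open>The squared distance as a machine expression\<close>

definition norm_expr :: "expr \<times> expr \<Rightarrow> expr" where
  "norm_expr e = Add (Mul (fst e) (fst e)) (Mul (snd e) (snd e))"

text \<open>It follows \<open>golden\<close> term by term, with the input addresses of y and the
  channel filled in. Nothing is cached: the expression has a fixed size, so recomputation affects
  only the constant.\<close>

definition objective_expr :: "expr \<times> expr \<Rightarrow> expr \<times> expr \<Rightarrow> expr \<times> expr \<Rightarrow> expr \<times> expr \<Rightarrow>
    (nat \<Rightarrow> expr) \<Rightarrow> expr" where
  "objective_expr e1 e2 e3 e4 ce =
    (let d = (\<lambda>k. Sub (Add (Mul (Const 2) (ce k)) (Const 1)) (Cell 25));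
         x = (\<lambda>k. (d (2 * k), d (2 * k + 1)));
         z1 = add_expr (mul_expr cos_expr (x 0)) (mul_expr sin_expr (x 1));
         z2 = sub_expr (mul_expr cos_expr (x 1)) (mul_expr sin_expr (x 0));
         z3 = add_expr (mul_expr cos_expr (x 2)) (mul_expr sin_expr (x 3));
         z4 = sub_expr (mul_expr cos_expr (x 3)) (mul_expr sin_expr (x 2));
         r = (\<lambda>y e h z e' h' z'. sub_expr (input_expr y)
               (add_expr (mul_expr (mul_expr e (input_expr h)) z) (mul_expr (mul_expr e' (input_expr h')) z'))) in
     Add (Add (Add (norm_expr (r 17 e1 1 z1 e3 9 z3)) (norm_expr (r 19 e2 11 z2 e4 3 z4)))
       (norm_expr (r 21 e1 5 z1 e3 13 z3))) (norm_expr (r 23 e2 15 z2 e4 7 z4)))"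

lemma norm_exprs:
  assumes "computes m r1 w1" "computes m r2 w2" "computes m r3 w3" "computes m r4 w4"
  shows "defined (Add (Add (Add (norm_expr r1) (norm_expr r2)) (norm_expr r3)) (norm_expr r4)) m \<and>
    eval (Add (Add (Add (norm_expr r1) (norm_expr r2)) (norm_expr r3)) (norm_expr r4)) m =
      (cmod w1)\<^sup>2 + (cmod w2)\<^sup>2 + (cmod w3)\<^sup>2 + (cmod w4)\<^sup>2"
  using assms unfolding cmod_power2 by (auto simp: computes_def norm_expr_def power2_eq_square)

lemma computes_input:
  assumes "\<And>c. c < 25 \<Longrightarrow> m c = input_memory M h y c"
  shows "computes m (input_expr 1) (h 1 1 1)" "computes m (input_expr 3) (h 1 1 2)"
    "computes m (input_expr 5) (h 1 2 1)" "computes m (input_expr 7) (h 1 2 2)"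
    "computes m (input_expr 9) (h 2 1 1)" "computes m (input_expr 11) (h 2 1 2)"
    "computes m (input_expr 13) (h 2 2 1)" "computes m (input_expr 15) (h 2 2 2)"
    "computes m (input_expr 17) (y $ 1)" "computes m (input_expr 19) (y $ 2)"
    "computes m (input_expr 21) (y $ 3)" "computes m (input_expr 23) (y $ 4)"
  unfolding computes_def input_expr_def
  by (simp_all add: assms input_memory_def input_list_def complex_eq_iff)

lemma objective_expr:
  assumes e: "\<And>m. computes m e1 p1" "\<And>m. computes m e2 p2" "\<And>m. computes m e3 p3" "\<And>m. computes m e4 p4"
    and m: "\<And>c. c < 25 \<Longrightarrow> m c = input_memory M h y c" "m 25 = real N"
    and ce: "\<And>k. k < 8 \<Longrightarrow> defined (ce k) m"
  shows "defined (objective_expr e1 e2 e3 e4 ce) m \<and>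
    eval (objective_expr e1 e2 e3 e4 ce) m = objective p1 p2 p3 p4 N h y (\<lambda>k. eval (ce k) m)"
proof -
  let ?d = "\<lambda>k. Sub (Add (Mul (Const 2) (ce k)) (Const 1)) (Cell 25)"
  let ?x = "symbols N (\<lambda>k. eval (ce k) m)"
  have x: "computes m (?d (2 * 0), ?d (2 * 0 + 1)) (?x $ 1)" "computes m (?d (2 * 1), ?d (2 * 1 + 1)) (?x $ 2)"
    "computes m (?d (2 * 2), ?d (2 * 2 + 1)) (?x $ 3)" "computes m (?d (2 * 3), ?d (2 * 3 + 1)) (?x $ 4)"
    by (simp_all add: computes_def ce m(2) symbols_def)
  note c = computes_arith computes_constants computes_input[OF m(1)] x e
  show ?thesis
    unfolding objective_expr_def objective_def golden_def Let_def norm_vec4 vector_4 vector_minus_component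
    by (rule norm_exprs; intro c)
qed

theorem mainTheorem2:
  fixes H :: "channel \<Rightarrow> complex^4^4"
  assumes "H \<in> {dayal_varanasi, belfiore_rekaya_viterbo, wimax}"
  shows "\<exists>(p :: prog) (C :: real).
    \<forall>(M :: nat) (h :: channel) (y :: complex^4). square_size M \<longrightarrow>
      (\<exists>t m. exec p (input_memory M h y) t m \<and>
             ml_decision (H h) M y (output_vector m) \<and>
             real t \<le> C * real M powr (5 / 2))"
proof -
  obtain p1 p2 p3 p4 where p: "computable p1" "computable p2" "computable p3" "computable p4"
    and H: "\<And>h x. H h *v x = golden p1 p2 p3 p4 h x"
    using golden_forms[OF assms] by blast
  \<comment> \<open>These are fixed before M, the channel and y, which makes the program and the
    constant uniform.\<close>
  obtain e1 e2 e3 e4 where e: "\<And>m. computes m e1 p1" "\<And>m. computes m e2 p2"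
      "\<And>m. computes m e3 p3" "\<And>m. computes m e4 p4"
    using p unfolding computable_def by metis
  let ?obj = "objective_expr e1 e2 e3 e4"
  have "\<exists>t m. exec (decoder ?obj) (input_memory M h y) t m \<and> ml_decision (H h) M y (output_vector m) \<and>
      real t \<le> real (cost (decoder ?obj) 1) * real M powr (5 / 2)" if "square_size M" for M h y
  proof -
    obtain N where N: "sqrt (real M) = real N" "2 \<le> N"
      using \<open>square_size M\<close> unfolding square_size_def by (auto elim!: Nats_cases)
    then have M: "real M = (real N)\<^sup>2" by (metis of_nat_0_le_iff real_sqrt_pow2)
    let ?F = "objective p1 p2 p3 p4 N h y"
    \<comment> \<open>The search sees the memory left by the first assignment, which puts sqrt M
      into cell 25.\<close>
    interpret search N "(input_memory M h y)(25 := real N)" ?obj ?F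
    proof
      show "0 < N" "((input_memory M h y)(25 := real N)) 25 = real N" using N by auto
      show "defined (?obj ce) m \<and> eval (?obj ce) m = ?F (\<lambda>k. eval (ce k) m)"
        if "\<And>c. c \<le> 25 \<Longrightarrow> m c = ((input_memory M h y)(25 := real N)) c" "\<And>k. k < 8 \<Longrightarrow> defined (ce k) m" for m ce
        by (rule objective_expr[where M = M]) (use e that in auto)
      show "?F u = ?F v" if "\<And>k. k < 8 \<Longrightarrow> u k = v k" for u v
        using that by (simp add: objective_def symbols_def)
      show "0 \<le> ?F u" for u by (simp add: objective_def)
      show "\<exists>a b c. \<forall>t. ?F (u(k := t)) = a * t\<^sup>2 + b * t + c" for k u
        using objective_quadratic unfolding quadratic_fun_def .
      show "?F u + ?F v = ?F (v(0 := u 0, 2 := u 2)) + ?F (v(1 := u 1, 3 := u 3))"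
        if "\<And>k. 4 \<le> k \<Longrightarrow> k < 8 \<Longrightarrow> u k = v k" for u v
        using that by (rule objective_separable)
    qed
    have "runs N (decoder ?obj) (input_memory M h y) (\<lambda>m'. \<exists>v\<in>grid N. (\<forall>u\<in>grid N. ?F v \<le> ?F u) \<and>
        (\<forall>k<8. m' k = 2 * v k + 1 - real N))"
      by (rule runs_decoder) (simp_all add: input_memory_def input_list_def M)
    then obtain t m v where t: "exec (decoder ?obj) (input_memory M h y) t m" "t \<le> cost (decoder ?obj) N"
      and v: "v \<in> grid N" "\<And>u. u \<in> grid N \<Longrightarrow> ?F v \<le> ?F u" and m: "\<And>k. k < 8 \<Longrightarrow> m k = 2 * v k + 1 - real N"
      unfolding runs_def by blast
    have out: "output_vector m = symbols N v"
      by (simp add: output_vector_def symbols_def m)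
    have "ml_decision (H h) M y (output_vector m)"
      unfolding ml_decision_def is_arg_min_def H out
    proof (intro conjI notI)
      show "\<forall>i. symbols N v $ i \<in> qam M"
        using symbols_grid[OF N(1)] v(1) by blast
      assume "\<exists>x. (\<forall>i. x $ i \<in> qam M) \<and>
        (norm (y - golden p1 p2 p3 p4 h x))\<^sup>2 < (norm (y - golden p1 p2 p3 p4 h (symbols N v)))\<^sup>2"
      then obtain x where x: "\<forall>i. x $ i \<in> qam M"
        "(norm (y - golden p1 p2 p3 p4 h x))\<^sup>2 < (norm (y - golden p1 p2 p3 p4 h (symbols N v)))\<^sup>2" by blast
      then obtain u where u: "u \<in> grid N" "x = symbols N u"
        using symbols_grid[OF N(1)] by blast
      show False using x(2) v(2)[OF u(1)] unfolding u(2) objective_def by linarith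
    qed
    moreover have "real t \<le> real (cost (decoder ?obj) 1) * real M powr (5 / 2)"
    proof -
      have "t \<le> cost (decoder ?obj) 1 * N ^ 5"
        using t(2) cost_le_power_depth[of N "decoder ?obj"] N(2) depth_decoder[of ?obj] by simp
      then have "real t \<le> real (cost (decoder ?obj) 1) * real N ^ 5"
        by (metis of_nat_le_iff of_nat_mult of_nat_power)
      \<comment> \<open>Since M = N^2, five loops of N passes amount to M^(5/2).\<close>
      also have "real N ^ 5 = real M powr (5 / 2)"
        using N(2) by (simp add: M powr_powr flip: powr_numeral)
      finally show ?thesis .
    qed
    ultimately show ?thesis using t(1) by blast
  qed
  then show ?thesis by blast
qed

end
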